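(* Let $c$ be a real number with $1<c<e$, where $e=2.718\ldots$ is Euler's number. Then for every integer $k\geq 0$ there is a number $N_k$ such that for all positive integers $n>N_k$, $$n^{\,n-\pi(n)}>c^{\,p_{n+k}}.$$
   Context: Here $p_m$ denotes the $m$-th prime number ($p_1=2$, $p_2=3$, ...), and $\pi(x)$ denotes the prime counting function, i.e. the number of primes not exceeding $x$. The number $N_k$ may depend on both $c$ and $k$. *)

theory Defs
  imports
    Complex_Main
    "HOL-Library.Infinite_Set"
    "HOL-Computational_Algebra.Primes"
begin

(* The sequence of primes is indexed from 1; enumerate counts from 0, hence the
   shift. The value at 0 carries no meaning. *)
definition nth_prime :: "nat \<Rightarrow> nat" where
  "nth_prime m = enumerate {p::nat. prime p} (m - 1)"

definition prime_pi :: "real \<Rightarrow> nat" where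
  "prime_pi x = card {p::nat. prime p \<and> real p \<le> x}"

lemma nth_prime_1: "nth_prime 1 = 2"
  by (auto simp: nth_prime_def enumerate_0 intro!: Least_equality prime_ge_2_nat)

(* Hence the subtraction n - prime_pi (real n) on natural numbers never truncates. *)
lemma prime_pi_le: "prime_pi (real n) \<le> n"
proof -
  have "{p::nat. prime p \<and> real p \<le> real n} \<subseteq> {1..n}"
    by (auto dest: prime_gt_0_nat)
  then have "card {p::nat. prime p \<and> real p \<le> real n} \<le> card {1..n}"
    by (intro card_mono) auto
  then show ?thesis
    by (simp add: prime_pi_def)
qed

end

theory Submission
  imports
    Defs
    "HOL-Number_Theory.Prime_Powers"
    "HOL-Complex_Analysis.Conformal_Mappings"
    "HOL-Probability.Sinc_Integral"
    "HOL-Real_Asymp.Real_Asymp"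
begin

text \<open>
  Taking logarithms, the claim becomes $p_{n+k} \ln c < (n - \pi(n)) \ln n$. Since $\ln c < 1$ and
  $\pi(n) = o(n)$ (\<open>prime_pi_density_0\<close>), it is enough that for every $b > 1$ one has
  $p_{n+k} \le b\, n \ln n$ for all large $n$ (\<open>nth_prime_upper\<close>). This upper bound is equivalent to
  the lower half of the prime number theorem, $\psi(x) \ge (1 - \delta) x$ for all large $x$
  (\<open>psi_lower_bound\<close>), where $\psi$ is Chebyshev's function; the passage uses only
  $\psi(x) \le \pi(x) \ln x$.

  The bound for $\psi$ is proved by a Wiener--Ikehara argument. Let $A(u) = \psi(e^u) e^{-u} - 1$ for
  $u \ge 0$ and $A(u) = 0$ otherwise; this is a bounded function by Chebyshev's estimate. Its Laplace
  transform at $w$ is $g(w) = -(Z'/Z(1+w) + 1)/(1+w)$ with $Z(s) = (s-1)\zeta(s)$. The function $Z$ extends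
  holomorphically to $\Re s > 0$ and has no zeros on $\Re s \ge 1$ (\<open>zeta_reg_nonzero\<close>), so $g$ is
  continuous up to the line $\Re w = 0$. Convolving $A$ with a Fejer kernel, whose Fourier
  transform has compact support, turns this continuity into an integral of $g$ over a compact piece of that line
  (\<open>smoothed_boundary_identity\<close>); by the Riemann--Lebesgue lemma the smoothed function tends
  to $0$ (\<open>smoothed_tendsto_0\<close>). Finally, $e^u (A(u) + 1) = \psi(e^u)$ is monotone, so a value
  $A(y) \le -\delta$ would force $A \le -\delta/2$ on an interval of fixed length to the left of $y$, and a
  sufficiently concentrated kernel would detect it (\<open>tauberian_lower\<close>).
\<close>

section \<open>Dirichlet series with logarithmically bounded coefficients\<close>

lemma summable_Suc_powr:
  assumes "a > 1"
  shows "summable (\<lambda>n. real (Suc n) powr (-a))"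
  using assms summable_real_powr_iff[of "-a"] 
  by (subst summable_Suc_iff[of "\<lambda>n. real n powr (-a)"]) auto

lemma norm_Suc_powr: "norm (of_nat (Suc n) powr (s::complex)) = real (Suc n) powr (Re s)"
  using norm_powr_real_powr[of "of_nat (Suc n)" s] by simp

lemma ln_times_powr_le:
  fixes a e :: real
  assumes "e > 0" "x \<ge> 1"
  shows "ln x * x powr (-a) \<le> (1/e) * x powr (-(a - e))"
proof -
  have "ln x * x powr (-a) \<le> (x powr e / e) * x powr (-a)"
    using assms by (intro mult_right_mono ln_powr_bound) auto
  also have "\<dots> = (1/e) * x powr (-(a - e))"
    by (simp add: powr_add [symmetric])
  finally show ?thesis .
qed

text \<open>
  The Dirichlet series $\sum_{m \ge 1} a_m m^{-s}$, with the coefficient $a_{n+1}$ stored as \<open>c n\<close>.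
  It is used only for $|a_m| \le 1 + \ln m$, where it converges absolutely on $\Re s > 1$.
\<close>
definition dirichlet_series :: "(nat \<Rightarrow> real) \<Rightarrow> complex \<Rightarrow> complex" where
  "dirichlet_series c s = (\<Sum>n. of_real (c n) * of_nat (Suc n) powr (-s))"

lemma summable_ln_powr:
  assumes "\<And>n. \<bar>c n\<bar> \<le> 1 + ln (real (Suc n))" "a > 1"
  shows "summable (\<lambda>n. \<bar>c n\<bar> * real (Suc n) powr (-a))"
proof -
  define e where "e = (a - 1) / 2"
  have e: "e > 0" "a - e > 1" using assms by (auto simp: e_def field_simps)
  show ?thesis
  proof (rule summable_comparison_test'[where N=0])
    show "summable (\<lambda>n. real (Suc n) powr (-a) + (1/e) * real (Suc n) powr (-(a-e)))"
      using e assms by (intro summable_add summable_mult summable_Suc_powr) auto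
    fix n :: nat
    have "\<bar>c n\<bar> * real (Suc n) powr (-a) \<le> (1 + ln (real (Suc n))) * real (Suc n) powr (-a)"
      by (intro mult_right_mono assms) auto
    also have "\<dots> \<le> real (Suc n) powr (-a) + (1/e) * real (Suc n) powr (-(a-e))"
      using ln_times_powr_le[of e "real (Suc n)" a] e by (simp add: distrib_right)
    finally show "norm (\<bar>c n\<bar> * real (Suc n) powr (-a)) \<le> \<dots>" by simp
  qed
qed

lemma summable_dirichlet_series:
  assumes "\<And>n. \<bar>c n\<bar> \<le> 1 + ln (real (Suc n))" "Re s > 1"
  shows "summable (\<lambda>n. norm (of_real (c n) * of_nat (Suc n) powr (-s)))"
  using summable_ln_powr[of c "Re s"] assms 
  by (simp add: norm_mult norm_Suc_powr del: of_nat_Suc)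

lemma dirichlet_series_has_derivative:
  assumes c: "\<And>n. \<bar>c n\<bar> \<le> 1 + ln (real (Suc n))" and s: "Re s > 1"
  shows "(dirichlet_series c has_field_derivative (- dirichlet_series (\<lambda>n. c n * ln (real (Suc n))) s)) (at s)"
proof -
  define S where "S = {s. Re s > 1}"
  have S: "open S" by (auto simp: S_def open_halfspace_Re_gt)
  have "\<exists>g g'. \<forall>x\<in>S. ((\<lambda>n. of_real (c n) * of_nat (Suc n) powr (-x)) sums g x) \<and>
          ((\<lambda>n. - (of_real (c n * ln (real (Suc n))) * of_nat (Suc n) powr (-x))) sums g' x) \<and> (g has_field_derivative g' x) (at x)"
  proof (rule series_and_derivative_comparison_local[OF S])
    fix n :: nat and x :: complex
    show "((\<lambda>x. of_real (c n) * of_nat (Suc n) powr (-x)) has_field_derivative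
            - (of_real (c n * ln (real (Suc n))) * of_nat (Suc n) powr (-x))) (at x)"
    proof -
      have "Ln (of_nat (Suc n)) = of_real (ln (real (Suc n)))"
        by (metis Ln_of_real of_nat_0_less_iff of_real_of_nat_eq zero_less_Suc)
      thus ?thesis
        by (auto intro!: derivative_eq_intros simp del: of_nat_Suc simp: powr_def)
    qed
  next
    fix x assume x: "x \<in> S"
    define a where "a = (1 + Re x) / 2"
    have a: "a > 1" "a < Re x" using x by (auto simp: a_def S_def)
    show "\<exists>d h. 0 < d \<and> summable h \<and> (\<forall>\<^sub>F n in sequentially. \<forall>y\<in>ball x d \<inter> S. norm (of_real (c n) * of_nat (Suc n) powr (-y)) \<le> h n)"
    proof (intro exI conjI)
      show "0 < Re x - a" using a by simp
      show "summable (\<lambda>n. \<bar>c n\<bar> * real (Suc n) powr (-a))" by (intro summable_ln_powr c a)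
      show "\<forall>\<^sub>F n in sequentially. \<forall>y\<in>ball x (Re x - a) \<inter> S. norm (of_real (c n) * of_nat (Suc n) powr (-y)) \<le> \<bar>c n\<bar> * real (Suc n) powr (-a)"
      proof (intro always_eventually allI ballI)
        fix n y assume "y \<in> ball x (Re x - a) \<inter> S"
        hence "\<bar>Re x - Re y\<bar> < Re x - a"
          using abs_Re_le_cmod[of "x - y"] by (auto simp: dist_norm)
        hence "a \<le> Re y" by simp
        thus "norm (of_real (c n) * of_nat (Suc n) powr (-y)) \<le> \<bar>c n\<bar> * real (Suc n) powr (-a)"
          by (auto simp: norm_mult norm_Suc_powr simp del: of_nat_Suc intro!: mult_left_mono powr_mono)
      qed
    qed
  qed
  then obtain g g' where g: "\<And>x. x \<in> S \<Longrightarrow> (\<lambda>n. of_real (c n) * of_nat (Suc n) powr (-x)) sums g x"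
     "\<And>x. x \<in> S \<Longrightarrow> (\<lambda>n. - (of_real (c n * ln (real (Suc n))) * of_nat (Suc n) powr (-x))) sums g' x"
     "\<And>x. x \<in> S \<Longrightarrow> (g has_field_derivative g' x) (at x)" by blast
  have sS: "s \<in> S" using s by (simp add: S_def)
  have 1: "g x = dirichlet_series c x" if "x \<in> S" for x
    using g(1)[OF that] by (simp add: dirichlet_series_def sums_iff)
  have 2: "g' s = - dirichlet_series (\<lambda>n. c n * ln (real (Suc n))) s"
    using sums_minus[OF g(2)[OF sS]] by (simp add: dirichlet_series_def sums_iff)
  show ?thesis
    using has_field_derivative_transform_within_open[OF g(3)[OF sS] S sS 1] 2 by simp
qed

lemma mangoldt_Suc_bound: "\<bar>mangoldt (Suc n) :: real\<bar> \<le> 1 + ln (real (Suc n))"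
proof (cases "n = 0")
  case False
  thus ?thesis using mangoldt_le[of "Suc n"] mangoldt_nonneg[of "Suc n"] by auto
qed auto

text \<open>
  The Dirichlet convolution identity $\zeta(s) \sum \Lambda(m) m^{-s} = \sum (\ln m) m^{-s}$; the right-hand side
  is $-\zeta'(s)$.
\<close>
lemma dirichlet_zeta_mangoldt:
  assumes s: "Re s > 1"
  shows "dirichlet_series (\<lambda>_. 1) s * dirichlet_series (\<lambda>n. mangoldt (Suc n)) s = dirichlet_series (\<lambda>n. ln (real (Suc n))) s"
proof -
  define N where "N = {n::nat. n > 0}"
  define f where "f = (\<lambda>n. of_nat n powr (-s) :: complex)"
  define M where "M = (\<lambda>n. of_real (mangoldt n) * f n)"
  have bij: "bij_betw Suc UNIV N" 
    unfolding N_def by (rule bij_betwI[where g="\<lambda>n. n - 1"]) auto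
  have hs: "((\<lambda>n. of_real (c n) * f n) has_sum dirichlet_series (\<lambda>n. c (Suc n)) s) N" and
       abs: "(\<lambda>n. norm (of_real (c n) * f n)) summable_on N"
    if "\<And>n. \<bar>c (Suc n)\<bar> \<le> 1 + ln (real (Suc n))" for c
  proof -
    have sm: "summable (\<lambda>n. norm (of_real (c (Suc n)) * f (Suc n)))"
      unfolding f_def by (intro summable_dirichlet_series that s)
    have "(\<lambda>n. of_real (c (Suc n)) * f (Suc n)) sums dirichlet_series (\<lambda>n. c (Suc n)) s"
      using summable_sums[OF summable_norm_cancel[OF sm]] by (simp add: dirichlet_series_def f_def)
    from norm_summable_imp_has_sum[OF sm this]
    show "((\<lambda>n. of_real (c n) * f n) has_sum dirichlet_series (\<lambda>n. c (Suc n)) s) N"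
      using has_sum_reindex_bij_betw[OF bij, of "\<lambda>n. of_real (c n) * f n"] by simp
    have "(\<lambda>n. norm (of_real (c (Suc n)) * f (Suc n))) summable_on UNIV"
      by (rule norm_summable_imp_summable_on) (use sm in simp)
    thus "(\<lambda>n. norm (of_real (c n) * f n)) summable_on N"
      using summable_on_reindex_bij_betw[OF bij, of "\<lambda>n. norm (of_real (c n) * f n)"] by simp
  qed
  have h1: "(f has_sum dirichlet_series (\<lambda>_. 1) s) N" "(\<lambda>n. norm (f n)) summable_on N"
    using hs[of "\<lambda>_. 1"] abs[of "\<lambda>_. 1"] by auto
  have h2: "(M has_sum dirichlet_series (\<lambda>n. mangoldt (Suc n)) s) N" "(\<lambda>n. norm (M n)) summable_on N"
    using hs[of mangoldt] abs[of mangoldt] mangoldt_Suc_bound by (auto simp: M_def)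
  have h3: "((\<lambda>n. of_real (ln (real n)) * f n) has_sum dirichlet_series (\<lambda>n. ln (real (Suc n))) s) N"
    using hs[of "\<lambda>n. ln (real n)"] by auto
  have prodsum: "(\<lambda>(m,d). f m * M d) summable_on N \<times> N"
  proof (rule abs_summable_summable, rule summable_on_SigmaI[where g="\<lambda>m. norm (f m) * infsum (\<lambda>d. norm (M d)) N"])
    show "((\<lambda>d. norm (case (m, d) of (m, d) \<Rightarrow> f m * M d)) has_sum (norm (f m) * infsum (\<lambda>d. norm (M d)) N)) N" for m
      using has_sum_cmult_right[OF has_sum_infsum[OF h2(2)], of "norm (f m)"] by (simp add: norm_mult)
    show "(\<lambda>m. norm (f m) * infsum (\<lambda>d. norm (M d)) N) summable_on N"
      by (intro summable_on_cmult_left h1)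
  qed auto
  have prod: "((\<lambda>(m,d). f m * M d) has_sum (dirichlet_series (\<lambda>_. 1) s * dirichlet_series (\<lambda>n. mangoldt (Suc n)) s)) (N \<times> N)"
    by (rule has_sum_SigmaI[OF _ _ prodsum, where g = "\<lambda>m. f m * dirichlet_series (\<lambda>n. mangoldt (Suc n)) s"])
       (auto intro!: has_sum_cmult_right has_sum_cmult_left h1 h2)
  \<comment> \<open>Reindexing pairs $(m, d)$ by their product $n = m d$ and the divisor $d$.\<close>
  have "((\<lambda>(n,d). of_real (mangoldt d) * f n) has_sum (dirichlet_series (\<lambda>_. 1) s * dirichlet_series (\<lambda>n. mangoldt (Suc n)) s)) (Sigma N (\<lambda>n. {d. d dvd n}))"
  proof (subst has_sum_reindex_bij_witness[where T="N \<times> N" and i="\<lambda>(m,d). (m*d,d)" and j="\<lambda>(n,d). (n div d,d)" and h="\<lambda>(m,d). f m * M d"])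
    show "((\<lambda>(m,d). f m * M d) has_sum (dirichlet_series (\<lambda>_. 1) s * dirichlet_series (\<lambda>n. mangoldt (Suc n)) s)) (N \<times> N)" by (fact prod)
    show "(case (case a of (n, d) \<Rightarrow> (n div d, d)) of (m, d) \<Rightarrow> f m * M d) =
         (case a of (n, d) \<Rightarrow> complex_of_real (mangoldt d) * f n)" if "a \<in> (SIGMA n:N. {d. d dvd n})" for a
    proof -
      obtain n d where a: "a = (n,d)" by (cases a)
      with that obtain m where m: "n = m * d" "m > 0" "d > 0" by (auto simp: N_def mult.commute)
      have "f n = f m * f d" unfolding f_def m 
        by (simp add: powr_times_real)
      thus ?thesis using m by (simp add: a M_def)
    qed
  qed (auto simp: N_def elim!: dvdE)
  moreover have "((\<lambda>d. of_real (mangoldt d) * f n) has_sum (of_real (ln (real n)) * f n)) {d. d dvd n}" if "n \<in> N" for n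
  proof -
    have "(\<Sum>d | d dvd n. of_real (mangoldt d) * f n) = of_real (ln (real n)) * f n"
      using mangoldt_sum[of n, where ?'a=complex] that by (simp add: N_def sum_distrib_right [symmetric])
    moreover have "finite {d. d dvd n}" using that by (auto simp: N_def)
    ultimately show ?thesis by (metis has_sum_finite)
  qed
  ultimately have "((\<lambda>n. of_real (ln (real n)) * f n) has_sum (dirichlet_series (\<lambda>_. 1) s * dirichlet_series (\<lambda>n. mangoldt (Suc n)) s)) N"
    by (rule has_sum_SigmaD[where f="\<lambda>(n,d). of_real (mangoldt d) * f n", unfolded prod.case])
  with h3 show ?thesis by (metis has_sum_unique)
qed

section \<open>Continuation of the zeta function\<close>

text \<open>
  With $a = n + 1$ this is $(s - 1) \int_a^{a+1} (a^{-s} - t^{-s})\, dt$, written without the integral. It is entire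
  in $s$ and, summed over $n$, compares $(s-1) \zeta(s)$ with $(s - 1) \int_1^\infty t^{-s}\, dt = 1$.
\<close>
definition zeta_reg_term :: "nat \<Rightarrow> complex \<Rightarrow> complex" where
  "zeta_reg_term n s = (s - 1) * of_nat (Suc n) powr (-s) - of_nat (Suc n) powr (1 - s) + of_nat (Suc (Suc n)) powr (1 - s)"

text \<open>
  The function $(s-1)\zeta(s)$, given by a series that converges for $\Re s > 0$. The factor $s - 1$ removes the
  pole, so that no removable singularity has to be treated at $s = 1$.
\<close>
definition zeta_reg :: "complex \<Rightarrow> complex" where
  "zeta_reg s = 1 + (\<Sum>n. zeta_reg_term n s)"

lemma norm_zeta_reg_term_le:
  assumes s: "Re s > 0"
  shows "norm (zeta_reg_term n s) \<le> norm (s - 1) * norm s * real (Suc n) powr (-Re s - 1)"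
proof -
  define a where "a = real (Suc n)"
  have a: "a > 0" by (simp add: a_def)
  define S where "S = complex_of_real ` {a..a+1}"
  have cvx: "convex S" unfolding S_def
    by (intro convex_linear_image convex_real_interval bounded_linear.linear bounded_linear_of_real)
  have aS: "of_real a \<in> S" "of_real (a + 1) \<in> S" 
    unfolding S_def by (rule imageI, simp)+
  define B where "B = norm s * a powr (-Re s - 1)"
  have nn: "z \<notin> \<real>\<^sub>\<le>\<^sub>0" if "z \<in> S" for z
    using that a by (auto simp: S_def complex_nonpos_Reals_iff)
  \<comment> \<open>The mean value inequality is applied twice: to $t^{-s}$, and to the primitive of $(s-1)(a^{-s} - t^{-s})$.\<close>
  have p: "norm (z powr (-s) - of_real a powr (-s)) \<le> B" if z: "z \<in> S" for z
  proof -
    have "norm (z powr (-s) - of_real a powr (-s)) \<le> B * norm (z - of_real a)"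
    proof (rule field_differentiable_bound[OF cvx _ _ z aS(1)])
      fix z assume z: "z \<in> S"
      show "((\<lambda>z. z powr (-s)) has_field_derivative (-s) * z powr (-s - 1)) (at z within S)"
        by (rule has_field_derivative_at_within[OF has_field_derivative_powr[OF nn[OF z]]])
      obtain x where x: "z = of_real x" "x \<ge> a" using z by (auto simp: S_def)
      have "norm (z powr (-s-1)) = x powr (-Re s - 1)"
        using x a norm_powr_real_powr[of z "-s-1"] by simp
      also have "\<dots> \<le> a powr (-Re s - 1)"
        using x a s by (intro powr_mono2') auto
      finally show "norm ((-s) * z powr (-s - 1)) \<le> B"
        unfolding B_def norm_mult norm_minus_cancel by (rule mult_left_mono) auto
    qed
    also have "norm (z - of_real a) \<le> 1" 
      using z by (auto simp: S_def simp flip: of_real_diff)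
    hence "B * norm (z - of_real a) \<le> B * 1" unfolding B_def
      by (intro mult_left_mono) auto
    finally show ?thesis by simp
  qed
  define q where "q = (\<lambda>z. (s - 1) * of_real a powr (-s) * z + z powr (1-s))"
  have "norm (q (of_real (a+1)) - q (of_real a)) \<le> (norm (s - 1) * B) * norm (complex_of_real (a+1) - of_real a)"
  proof (rule field_differentiable_bound[OF cvx _ _ aS(2,1)])
    fix z assume z: "z \<in> S"
    show "(q has_field_derivative (s - 1) * of_real a powr (-s) + (1-s) * z powr (1-s-1)) (at z within S)"
      unfolding q_def
      using DERIV_add[OF DERIV_cmult_Id has_field_derivative_at_within[OF has_field_derivative_powr[OF nn[OF z], of "1-s"]]]
      by simp
    have "(s - 1) * of_real a powr (-s) + (1-s) * z powr (1-s-1) = - (s - 1) * (z powr (-s) - of_real a powr (-s))"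
      by (simp add: algebra_simps)
    thus "norm ((s - 1) * of_real a powr (-s) + (1-s) * z powr (1-s-1)) \<le> norm (s - 1) * B"
      using p[OF z] by (simp only: norm_mult norm_minus_cancel) (rule mult_left_mono, auto)
  qed
  also have "norm (complex_of_real (a+1) - of_real a) = 1" by simp
  also have "q (of_real (a+1)) - q (of_real a) = zeta_reg_term n s"
  proof -
    have e: "complex_of_real a = of_nat (Suc n)" "complex_of_real (a + 1) = of_nat (Suc (Suc n))" by (auto simp: a_def)
    have e2: "of_nat (Suc (Suc n)) = (of_nat (Suc n) + 1 :: complex)" by simp
    show ?thesis unfolding q_def zeta_reg_term_def e
      by (subst (1) e2) (simp only: algebra_simps, simp)
  qed
  finally show ?thesis by (simp add: B_def a_def mult.assoc)
qed

lemma zeta_reg_series: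
  "\<exists>g'. \<forall>s. Re s > 0 \<longrightarrow> (\<lambda>n. zeta_reg_term n s) sums (zeta_reg s - 1) \<and> (zeta_reg has_field_derivative g' s) (at s)"
proof -
  define S where "S = {s. Re s > 0}"
  have S: "open S" by (auto simp: S_def open_halfspace_Re_gt)
  have "\<exists>g g'. \<forall>x\<in>S. ((\<lambda>n. zeta_reg_term n x) sums g x) \<and>
          ((\<lambda>n. deriv (zeta_reg_term n) x) sums g' x) \<and> (g has_field_derivative g' x) (at x)"
  proof (rule series_and_derivative_comparison_local[OF S])
    fix n x 
    have "zeta_reg_term n = (\<lambda>s. (s - 1) * exp (-s * Ln (of_nat (Suc n))) - exp ((1 - s) * Ln (of_nat (Suc n)))
            + exp ((1 - s) * Ln (of_nat (Suc (Suc n)))))"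
      by (rule ext) (simp add: zeta_reg_term_def powr_def del: of_nat_Suc)
    hence "zeta_reg_term n holomorphic_on UNIV"
      by (simp only:) (intro holomorphic_on_add holomorphic_on_diff holomorphic_on_mult holomorphic_on_exp' holomorphic_on_const holomorphic_on_ident holomorphic_on_minus)
    hence "zeta_reg_term n field_differentiable (at x)"
      by (rule holomorphic_on_imp_differentiable_at) auto
    thus "(zeta_reg_term n has_field_derivative deriv (zeta_reg_term n) x) (at x)"
      by (simp add: field_differentiable_derivI)
  next
    fix x assume x: "x \<in> S"
    define d where "d = Re x / 2"
    have d: "d > 0" using x by (auto simp: d_def S_def)
    define B where "B = norm x + d"
    have B: "B \<ge> 0" using d by (simp add: B_def)
    show "\<exists>d h. 0 < d \<and> summable h \<and> (\<forall>\<^sub>F n in sequentially. \<forall>y\<in>ball x d \<inter> S. norm (zeta_reg_term n y) \<le> h n)"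
    proof (intro exI conjI)
      show "0 < d" by (rule d)
      show "summable (\<lambda>n. (B + 1) * B * real (Suc n) powr (-(d + 1)))"
        using d by (intro summable_mult summable_Suc_powr) auto
      show "\<forall>\<^sub>F n in sequentially. \<forall>y\<in>ball x d \<inter> S. norm (zeta_reg_term n y) \<le> (B + 1) * B * real (Suc n) powr (-(d + 1))"
      proof (intro always_eventually allI ballI)
        fix n y assume y: "y \<in> ball x d \<inter> S"
        hence "\<bar>Re x - Re y\<bar> < d" "norm (x - y) < d"
          using abs_Re_le_cmod[of "x - y"] by (auto simp: dist_norm)
        hence 1: "d \<le> Re y" unfolding d_def by linarith
        have 2: "norm y \<le> B" unfolding B_def
          using norm_triangle_ineq2[of y x] \<open>norm (x - y) < d\<close> norm_minus_commute[of x y] by linarith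
        have 3: "norm (y - 1) \<le> B + 1"
          using 2 norm_triangle_ineq4[of y 1] by simp
        have "norm (zeta_reg_term n y) \<le> norm (y - 1) * norm y * real (Suc n) powr (-Re y - 1)"
          using y by (intro norm_zeta_reg_term_le) (auto simp: S_def)
        also have "\<dots> \<le> (B + 1) * B * real (Suc n) powr (-(d + 1))"
          using 1 2 3 B by (intro mult_mono powr_mono) auto
        finally show "norm (zeta_reg_term n y) \<le> \<dots>" .
      qed
    qed
  qed
  then obtain g g' where g: "\<And>x. x \<in> S \<Longrightarrow> (\<lambda>n. zeta_reg_term n x) sums g x"
     "\<And>x. x \<in> S \<Longrightarrow> (g has_field_derivative g' x) (at x)" by blast
  have 1: "1 + g x = zeta_reg x" if "x \<in> S" for x
    using g(1)[OF that] by (simp add: zeta_reg_def sums_iff)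
  show ?thesis
  proof (intro exI[of _ g'] allI impI conjI)
    fix s assume "Re s > 0"
    hence s: "s \<in> S" by (simp add: S_def)
    show "(\<lambda>n. zeta_reg_term n s) sums (zeta_reg s - 1)" using g(1)[OF s] 1[OF s] by (simp add: algebra_simps flip: 1[OF s])
    have "((\<lambda>x. 1 + g x) has_field_derivative g' s) (at s)"
      using g(2)[OF s] by (auto intro!: derivative_eq_intros)
    thus "(zeta_reg has_field_derivative g' s) (at s)"
      by (rule has_field_derivative_transform_within_open[OF _ S s]) (rule 1)
  qed
qed

lemma holomorphic_zeta_reg: "zeta_reg holomorphic_on {s. Re s > 0}"
  using zeta_reg_series by (auto simp: holomorphic_on_def field_differentiable_def intro: has_field_derivative_at_within)

lemma zeta_reg_1 [simp]: "zeta_reg 1 = 1"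
proof -
  have "zeta_reg_term n 1 = 0" for n
    using of_nat_neq_0[of n] of_nat_neq_0[of "Suc n"] by (simp add: zeta_reg_term_def powr_def del: of_nat_Suc)
  thus ?thesis by (simp add: zeta_reg_def)
qed

lemma zeta_reg_eq:
  assumes s: "Re s > 1"
  shows "zeta_reg s = (s - 1) * dirichlet_series (\<lambda>_. 1) s"
proof -
  have 1: "(\<lambda>n. (s - 1) * of_nat (Suc n) powr (-s)) sums ((s - 1) * dirichlet_series (\<lambda>_. 1) s)"
    using summable_norm_cancel[OF summable_dirichlet_series[of "\<lambda>_. 1" s]] s
    unfolding dirichlet_series_def by (intro sums_mult summable_sums) auto
  define f where "f = (\<lambda>n. of_nat (Suc n) powr (1 - s))"
  have "f \<longlonglongrightarrow> 0"
  proof (rule tendsto_norm_zero_cancel)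
    have "(\<lambda>n. real (Suc n) powr (1 - Re s)) \<longlonglongrightarrow> 0"
      using s by (intro tendsto_neg_powr filterlim_compose[OF filterlim_real_sequentially filterlim_Suc]) auto
    thus "(\<lambda>n. norm (f n)) \<longlonglongrightarrow> 0"
      unfolding f_def by (simp add: norm_Suc_powr del: of_nat_Suc)
  qed
  from telescope_sums[OF this] have 2: "(\<lambda>n. f (Suc n) - f n) sums (0 - 1)"
    by (simp add: f_def)
  have "(\<lambda>n. zeta_reg_term n s) sums ((s - 1) * dirichlet_series (\<lambda>_. 1) s + (0 - 1))"
    using sums_add[OF 1 2] by (simp add: zeta_reg_term_def f_def algebra_simps del: of_nat_Suc)
  moreover have "(\<lambda>n. zeta_reg_term n s) sums (zeta_reg s - 1)" using zeta_reg_series s by force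
  ultimately have "zeta_reg s - 1 = (s - 1) * dirichlet_series (\<lambda>_. 1) s + (0 - 1)"
    using sums_unique2 by blast
  thus ?thesis by (simp add: algebra_simps)
qed

text \<open>
  The series $\sum_{m \ge 1} \Lambda(m) m^{-s} = -\zeta'(s)/\zeta(s)$.
\<close>
abbreviation "mangoldt_series \<equiv> dirichlet_series (\<lambda>n. mangoldt (Suc n))"

text \<open>
  Multiplied out, this says $Z'/Z = 1/(s-1) - \sum \Lambda(m) m^{-s}$. The product form does not require
  $Z(s) \ne 0$, and is what proves that $Z$ has no zeros for $\Re s > 1$.
\<close>
lemma deriv_zeta_reg_eq:
  assumes s: "Re s > 1"
  shows "(s - 1) * deriv zeta_reg s = zeta_reg s * (1 - (s - 1) * mangoldt_series s)"
proof -
  let ?z = "dirichlet_series (\<lambda>_. 1)"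
  have "(?z has_field_derivative - (?z s * mangoldt_series s)) (at s)"
    using dirichlet_series_has_derivative[of "\<lambda>_. 1", OF _ s] dirichlet_zeta_mangoldt[OF s] by simp
  hence "((\<lambda>s. (s - 1) * ?z s) has_field_derivative (?z s - (s - 1) * (?z s * mangoldt_series s))) (at s)"
    by (auto intro!: derivative_eq_intros simp: algebra_simps)
  hence "(zeta_reg has_field_derivative (?z s - (s - 1) * (?z s * mangoldt_series s))) (at s)"
    by (rule has_field_derivative_transform_within_open[where S="{s. Re s > 1}"])
       (use s zeta_reg_eq in \<open>auto simp: open_halfspace_Re_gt\<close>)
  hence "deriv zeta_reg s = ?z s - (s - 1) * (?z s * mangoldt_series s)" by (rule DERIV_imp_deriv)
  hence "(s - 1) * deriv zeta_reg s = ((s - 1) * ?z s) * (1 - (s - 1) * mangoldt_series s)" 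
    by (simp only:) (simp add: algebra_simps)
  thus ?thesis using zeta_reg_eq[OF s] by simp
qed

section \<open>Non-vanishing on the line with real part one\<close>

text \<open>
  The limit of $(z - \xi) f'(z)/f(z)$ at $\xi$ is the order of vanishing of $f$ there.
\<close>
lemma log_deriv_limit:
  fixes f :: "complex \<Rightarrow> complex"
  assumes f: "f holomorphic_on S" and S: "open S" "connected S" and xi: "\<xi> \<in> S" and w: "w \<in> S" "f w \<noteq> 0"
  shows "\<exists>m::nat. ((\<lambda>z. (z - \<xi>) * deriv f z / f z) \<longlongrightarrow> of_nat m) (at \<xi>) \<and> (f \<xi> = 0 \<longleftrightarrow> m > 0)"
proof (cases "f \<xi> = 0")
  case False
  have "isCont f \<xi>" "isCont (deriv f) \<xi>"
    using holomorphic_on_imp_continuous_on[OF f] holomorphic_on_imp_continuous_on[OF holomorphic_deriv[OF f S(1)]]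
    by (simp_all add: continuous_on_eq_continuous_at[OF S(1)] xi)
  hence "isCont (\<lambda>z. (z - \<xi>) * deriv f z / f z) \<xi>"
    using False by (intro continuous_divide continuous_mult continuous_diff continuous_ident continuous_const) auto
  hence "((\<lambda>z. (z - \<xi>) * deriv f z / f z) \<longlongrightarrow> of_nat 0) (at \<xi>)"
    by (simp add: isCont_def)
  thus ?thesis using False by blast
next
  case True
  have nc: "\<not> f constant_on S" using True w xi unfolding constant_on_def by metis
  obtain g r n where
    g: "0 < n" "0 < r" "ball \<xi> r \<subseteq> S" "g holomorphic_on ball \<xi> r"
       "\<And>w. w \<in> ball \<xi> r \<Longrightarrow> f w = (w - \<xi>)^n * g w" "\<And>w. w \<in> ball \<xi> r \<Longrightarrow> g w \<noteq> 0"
    using that by (rule holomorphic_factor_zero_nonconstant[OF f S xi True nc])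
  have c: "\<xi> \<in> ball \<xi> r" using g by simp
  have "isCont g \<xi>" "isCont (deriv g) \<xi>"
    using holomorphic_on_imp_continuous_on[OF g(4)] holomorphic_on_imp_continuous_on[OF holomorphic_deriv[OF g(4) open_ball]] c
    by (simp_all add: continuous_on_eq_continuous_at[OF open_ball])
  hence "isCont (\<lambda>z. of_nat n + (z - \<xi>) * deriv g z / g z) \<xi>"
    using g(6)[OF c]
    by (intro continuous_add continuous_divide continuous_mult continuous_diff continuous_ident continuous_const) auto
  hence "((\<lambda>z. of_nat n + (z - \<xi>) * deriv g z / g z) \<longlongrightarrow> of_nat n) (at \<xi>)"
    by (simp add: isCont_def)
  moreover have "eventually (\<lambda>z. (z - \<xi>) * deriv f z / f z = of_nat n + (z - \<xi>) * deriv g z / g z) (at \<xi>)"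
    unfolding eventually_at
  proof (intro exI[of _ r] conjI ballI impI g)
    fix z assume z: "z \<noteq> \<xi> \<and> dist z \<xi> < r"
    hence zb: "z \<in> ball \<xi> r" by (simp add: dist_commute)
    have "(g has_field_derivative deriv g z) (at z)"
      using g(4) zb holomorphic_derivI open_ball by blast
    hence "((\<lambda>w. (w - \<xi>)^n * g w) has_field_derivative of_nat n * (z - \<xi>)^(n-1) * g z + (z - \<xi>)^n * deriv g z) (at z)"
      by (auto intro!: derivative_eq_intros)
    hence "(f has_field_derivative of_nat n * (z - \<xi>)^(n-1) * g z + (z - \<xi>)^n * deriv g z) (at z)"
      by (rule has_field_derivative_transform_within_open[OF _ open_ball zb]) (use g(5) in auto)
    hence d: "deriv f z = of_nat n * (z - \<xi>)^(n-1) * g z + (z - \<xi>)^n * deriv g z"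
      by (rule DERIV_imp_deriv)
    define u p where "u = z - \<xi>" and "p = (z - \<xi>)^(n-1)"
    have pw: "(z - \<xi>)^n = u * p" using g(1) unfolding u_def p_def by (metis power_minus_mult mult.commute)
    have "u \<noteq> 0" "p \<noteq> 0" using z by (auto simp: u_def p_def)
    thus "(z - \<xi>) * deriv f z / f z = of_nat n + (z - \<xi>) * deriv g z / g z"
      using g(6)[OF zb] unfolding d g(5)[OF zb] pw unfolding p_def[symmetric] unfolding u_def[symmetric] by (simp add: field_simps)
  qed
  ultimately have "((\<lambda>z. (z - \<xi>) * deriv f z / f z) \<longlongrightarrow> of_nat n) (at \<xi>)"
    by (simp add: tendsto_cong)
  thus ?thesis using True g(1) by blast
qed

lemma zeta_reg_log_deriv_limit:
  assumes "Re \<xi> > 0"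
  shows "\<exists>m::nat. ((\<lambda>z. (z - \<xi>) * deriv zeta_reg z / zeta_reg z) \<longlongrightarrow> of_nat m) (at \<xi>) \<and> (zeta_reg \<xi> = 0 \<longleftrightarrow> m > 0)"
  by (rule log_deriv_limit[OF holomorphic_zeta_reg, where w=1])
     (use assms in \<open>auto simp: open_halfspace_Re_gt intro!: convex_connected convex_halfspace_Re_gt\<close>)

lemma isCont_mangoldt_series: "Re s > 1 \<Longrightarrow> isCont mangoldt_series s"
  using dirichlet_series_has_derivative[of "\<lambda>n. mangoldt (Suc n)", OF mangoldt_Suc_bound] DERIV_isCont by blast

text \<open>
  The logarithmic derivative of $Z$ is bounded near a point with $\Re s > 1$, so the order of vanishing is $0$.
\<close>
lemma zeta_reg_nonzero_Re_gt_1: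
  assumes s: "Re s > 1"
  shows "zeta_reg s \<noteq> 0"
proof -
  obtain m where m: "((\<lambda>z. (z - s) * deriv zeta_reg z / zeta_reg z) \<longlongrightarrow> of_nat m) (at s)" "zeta_reg s = 0 \<longleftrightarrow> m > 0"
    using zeta_reg_log_deriv_limit[of s] s by auto
  have "s \<noteq> 1" using s by auto
  have "isCont (\<lambda>z. (z - s) * (1 / (z - 1) - mangoldt_series z)) s"
    using \<open>s \<noteq> 1\<close> by (intro continuous_mult continuous_diff continuous_divide continuous_ident continuous_const isCont_mangoldt_series s) auto
  hence lim: "((\<lambda>z. (z - s) * (1 / (z - 1) - mangoldt_series z)) \<longlongrightarrow> 0) (at s)" by (simp add: isCont_def)
  have "\<forall>\<^sub>F z in at s. z \<in> {z. Re z > 1}"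
    using s by (intro eventually_at_in_open' open_halfspace_Re_gt) auto
  hence "\<forall>\<^sub>F z in at s. norm ((z - s) * deriv zeta_reg z / zeta_reg z) \<le> norm ((z - s) * (1 / (z - 1) - mangoldt_series z))"
  proof eventually_elim
    case (elim z)
    hence z: "Re z > 1" and z1: "z \<noteq> 1" by auto
    show ?case
    \<comment> \<open>At a zero of \<open>zeta_reg\<close> the quotient is $0$ by convention, so the inequality still holds.\<close>
    proof (cases "zeta_reg z = 0")
      case False
      have "deriv zeta_reg z / zeta_reg z = 1 / (z - 1) - mangoldt_series z"
        using deriv_zeta_reg_eq[OF z] False z1 by (simp add: field_simps)
      thus ?thesis by (metis order_refl times_divide_eq_right)
    qed auto
  qed
  hence "((\<lambda>z. (z - s) * deriv zeta_reg z / zeta_reg z) \<longlongrightarrow> 0) (at s)"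
    by (intro Lim_null_comparison[OF _ tendsto_norm_zero[OF lim]])
  with m(1) have "complex_of_nat m = 0" using tendsto_unique[OF _ m(1)] by auto
  thus ?thesis using m(2) by auto
qed

text \<open>
  On the line $\Re s = 1$, the series $\sum \Lambda(m) m^{-s}$ behaves like a simple pole whose residue is $-m$,
  where $m$ is the order of the zero of $Z$, plus $1$ at $s = 1$ from the pole of $\zeta$.
\<close>
lemma mangoldt_series_boundary_limit:
  "\<exists>m::nat. ((\<lambda>e::real. Re (e * mangoldt_series (1 + of_real e + \<i> * of_real t))) \<longlongrightarrow> (if t = 0 then 1 else 0) - real m) (at_right 0) 
      \<and> (zeta_reg (1 + \<i> * of_real t) = 0 \<longleftrightarrow> m > 0)"
proof -
  define \<xi> where "\<xi> = 1 + \<i> * of_real t"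
  obtain m where m: "((\<lambda>z. (z - \<xi>) * deriv zeta_reg z / zeta_reg z) \<longlongrightarrow> of_nat m) (at \<xi>)" "zeta_reg \<xi> = 0 \<longleftrightarrow> m > 0"
    using zeta_reg_log_deriv_limit[of \<xi>] by (auto simp: \<xi>_def)
  have fl: "filterlim (\<lambda>e::real. of_real e + \<xi>) (at \<xi>) (at_right 0)"
    unfolding filterlim_at
    by (auto intro!: tendsto_eq_intros eventually_mono[OF eventually_at_right_less[of 0]])
  have 1: "((\<lambda>e::real. of_real e * deriv zeta_reg (of_real e + \<xi>) / zeta_reg (of_real e + \<xi>)) \<longlongrightarrow> of_nat m) (at_right 0)"
    using filterlim_compose[OF m(1) fl] by simp
  have 2: "((\<lambda>e::real. of_real e / (of_real e + \<i> * of_real t)) \<longlongrightarrow> (if t = 0 then 1 else 0 :: complex)) (at_right 0)"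
  proof (cases "t = 0")
    case True
    have "\<forall>\<^sub>F e::real in at_right 0. 1 = complex_of_real e / (of_real e + \<i> * of_real t)"
      using True eventually_at_right_less[of "0::real"] by (auto elim!: eventually_mono)
    thus ?thesis using True by (auto intro: Lim_transform_eventually[OF tendsto_const])
  qed (auto intro!: tendsto_eq_intros)
  have "((\<lambda>e::real. of_real e / (of_real e + \<i> * of_real t) - of_real e * deriv zeta_reg (of_real e + \<xi>) / zeta_reg (of_real e + \<xi>))
           \<longlongrightarrow> (if t = 0 then 1 else 0) - of_nat m) (at_right 0)"
    by (intro tendsto_diff 1 2)
  moreover have "\<forall>\<^sub>F e::real in at_right 0. of_real e / (of_real e + \<i> * of_real t) - of_real e * deriv zeta_reg (of_real e + \<xi>) / zeta_reg (of_real e + \<xi>)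
       = of_real e * mangoldt_series (1 + of_real e + \<i> * of_real t)"
    using eventually_at_right_less[of "0::real"]
  proof eventually_elim
    case (elim e)
    define z where "z = of_real e + \<xi>"
    have z: "Re z > 1" "z \<noteq> 1" "zeta_reg z \<noteq> 0" using elim zeta_reg_nonzero_Re_gt_1[of z] by (auto simp: z_def \<xi>_def complex_eq_iff)
    have "deriv zeta_reg z / zeta_reg z = 1 / (z - 1) - mangoldt_series z"
      using deriv_zeta_reg_eq[OF z(1)] z by (simp add: field_simps)
    hence "of_real e * (deriv zeta_reg z / zeta_reg z) = of_real e * (1 / (z - 1) - mangoldt_series z)"
      by (rule arg_cong)
    hence "of_real e * (deriv zeta_reg z / zeta_reg z) = of_real e / (z - 1) - of_real e * mangoldt_series z"
      by (simp add: right_diff_distrib)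
    moreover have "z - 1 = of_real e + \<i> * of_real t" "z = 1 + of_real e + \<i> * of_real t" by (auto simp: z_def \<xi>_def)
    ultimately show ?case by (simp add: z_def[symmetric])
  qed
  ultimately have "((\<lambda>e::real. of_real e * mangoldt_series (1 + of_real e + \<i> * of_real t))
           \<longlongrightarrow> (if t = 0 then 1 else 0) - of_nat m) (at_right 0)"
    by (rule Lim_transform_eventually)
  from tendsto_Re[OF this] show ?thesis using m(2) unfolding \<xi>_def
    by (intro exI[of _ m]) (auto split: if_splits)
qed

text \<open>
  Coming from $3 + 4 \cos\theta + \cos 2\theta = 2 (1 + \cos\theta)^2 \ge 0$.
\<close>
lemma mangoldt_series_3_4_1:
  assumes "e > 0"
  shows "3 * Re (mangoldt_series (1 + of_real e + \<i> * of_real 0)) + 4 * Re (mangoldt_series (1 + of_real e + \<i> * of_real t)) 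
          + Re (mangoldt_series (1 + of_real e + \<i> * of_real (2*t))) \<ge> 0"
proof -
  define c where "c = (\<lambda>n. mangoldt (Suc n) * real (Suc n) powr (-(1+e)))"
  have re: "(\<lambda>n. c n * cos (u * ln (real (Suc n)))) sums Re (mangoldt_series (1 + of_real e + \<i> * of_real u))" for u
  proof -
    have "(\<lambda>n. of_real (mangoldt (Suc n)) * of_nat (Suc n) powr (-(1 + of_real e + \<i> * of_real u))) sums mangoldt_series (1 + of_real e + \<i> * of_real u)"
      unfolding dirichlet_series_def using assms
      by (intro summable_sums summable_norm_cancel[OF summable_dirichlet_series] mangoldt_Suc_bound) auto
    from sums_Re[OF this] show ?thesis
    proof (rule sums_cong[THEN iffD1, rotated])
      fix n
      have "Ln (of_nat (Suc n)) = of_real (ln (real (Suc n)))"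
        by (metis Ln_of_real of_nat_0_less_iff of_real_of_nat_eq zero_less_Suc)
      hence "of_nat (Suc n) powr (-(1 + of_real e + \<i> * of_real u)) = 
          exp (Complex (-(1+e) * ln (real (Suc n))) (- (u * ln (real (Suc n)))))"
        by (simp add: powr_def Complex_eq algebra_simps del: of_nat_Suc)
      hence "Re (of_nat (Suc n) powr (-(1 + of_real e + \<i> * of_real u))) = real (Suc n) powr (-(1+e)) * cos (u * ln (real (Suc n)))"
        by (simp add: Re_exp powr_def del: of_nat_Suc)
      thus "Re (of_real (mangoldt (Suc n)) * of_nat (Suc n) powr (-(1 + of_real e + \<i> * of_real u))) = c n * cos (u * ln (real (Suc n)))"
        unfolding c_def by (simp del: of_nat_Suc)
    qed
  qed
  have s: "(\<lambda>n. 3 * (c n * cos (0 * ln (real (Suc n)))) + 4 * (c n * cos (t * ln (real (Suc n)))) + c n * cos (2 * t * ln (real (Suc n))))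
    sums (3 * Re (mangoldt_series (1 + of_real e + \<i> * of_real 0)) + 4 * Re (mangoldt_series (1 + of_real e + \<i> * of_real t)) 
          + Re (mangoldt_series (1 + of_real e + \<i> * of_real (2*t))))"
    by (intro sums_add sums_mult re)
  have "0 \<le> 3 * (c n * cos (0 * ln (real (Suc n)))) + 4 * (c n * cos (t * ln (real (Suc n)))) + c n * cos (2 * t * ln (real (Suc n)))" for n
  proof -
    define \<theta> where "\<theta> = t * ln (real (Suc n))"
    have "3 * (c n * cos (0 * ln (real (Suc n)))) + 4 * (c n * cos \<theta>) + c n * cos (2 * \<theta>) = c n * (2 * (1 + cos \<theta>)\<^sup>2)"
      unfolding cos_double_cos by (simp add: power2_eq_square algebra_simps)
    also have "\<dots> \<ge> 0" unfolding c_def by (intro mult_nonneg_nonneg mangoldt_nonneg) auto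
    finally show ?thesis by (simp add: \<theta>_def mult.assoc)
  qed
  from sums_le[OF this sums_zero s] show ?thesis .
qed

text \<open>
  If $m_1$ and $m_2$ are the orders of the zeros at $1 + it$ and $1 + 2it$, then the previous inequality gives
  $3 - 4 m_1 - m_2 \ge 0$ in the limit, hence $m_1 = 0$.
\<close>
lemma zeta_reg_nonzero:
  assumes s: "Re s \<ge> 1"
  shows "zeta_reg s \<noteq> 0"
proof (cases "Re s = 1 \<and> s \<noteq> 1")
  case True
  define t where "t = Im s"
  have st: "s = 1 + \<i> * of_real t" "t \<noteq> 0" using True by (auto simp: t_def complex_eq_iff)
  obtain m0 m1 m2 :: nat where
    m0: "((\<lambda>e::real. Re (e * mangoldt_series (1 + of_real e + \<i> * of_real 0))) \<longlongrightarrow> 1 - real m0) (at_right 0)" "zeta_reg (1 + \<i> * of_real 0) = 0 \<longleftrightarrow> m0 > 0" and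
    m1: "((\<lambda>e::real. Re (e * mangoldt_series (1 + of_real e + \<i> * of_real t))) \<longlongrightarrow> 0 - real m1) (at_right 0)" "zeta_reg (1 + \<i> * of_real t) = 0 \<longleftrightarrow> m1 > 0" and
    m2: "((\<lambda>e::real. Re (e * mangoldt_series (1 + of_real e + \<i> * of_real (2*t)))) \<longlongrightarrow> 0 - real m2) (at_right 0)"
    using mangoldt_series_boundary_limit[of 0] mangoldt_series_boundary_limit[of t] mangoldt_series_boundary_limit[of "2*t"] st(2) by auto
  have m0': "m0 = 0" using m0(2) by simp
  have "((\<lambda>e::real. 3 * Re (e * mangoldt_series (1 + of_real e + \<i> * of_real 0)) + 4 * Re (e * mangoldt_series (1 + of_real e + \<i> * of_real t)) + Re (e * mangoldt_series (1 + of_real e + \<i> * of_real (2*t)))) 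
     \<longlongrightarrow> 3 * (1 - real m0) + 4 * (0 - real m1) + (0 - real m2)) (at_right 0)"
    by (intro tendsto_intros m0 m1 m2)
  moreover have "\<forall>\<^sub>F e::real in at_right 0. 0 \<le> 3 * Re (e * mangoldt_series (1 + of_real e + \<i> * of_real 0)) + 4 * Re (e * mangoldt_series (1 + of_real e + \<i> * of_real t)) + Re (e * mangoldt_series (1 + of_real e + \<i> * of_real (2*t)))"
    using eventually_at_right_less[of "0::real"]
  proof eventually_elim
    case (elim e)
    have "0 \<le> e * (3 * Re (mangoldt_series (1 + of_real e + \<i> * of_real 0)) + 4 * Re (mangoldt_series (1 + of_real e + \<i> * of_real t)) 
          + Re (mangoldt_series (1 + of_real e + \<i> * of_real (2*t))))"
      using elim mangoldt_series_3_4_1[of e t] by (intro mult_nonneg_nonneg) auto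
    thus ?case by (simp add: algebra_simps)
  qed
  ultimately have "0 \<le> 3 * (1 - real m0) + 4 * (0 - real m1) + (0 - real m2)"
    by (rule tendsto_lowerbound) auto
  hence "real m1 < 1" using m0' by simp
  hence "m1 = 0" by simp
  thus ?thesis using m1(2) st by auto
qed (use s zeta_reg_nonzero_Re_gt_1[of s] in auto)

section \<open>Chebyshev estimates\<close>

text \<open>
  Chebyshev's function $\psi(x) = \sum_{d \le x} \Lambda(d)$.
\<close>
definition psi :: "real \<Rightarrow> real" where
  "psi x = (\<Sum>d\<in>{1..nat \<lfloor>x\<rfloor>}. mangoldt d)"

lemma psi_nonneg: "psi x \<ge> 0"
  unfolding psi_def by (intro sum_nonneg mangoldt_nonneg)

lemma psi_mono: "x \<le> y \<Longrightarrow> psi x \<le> psi y"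
  unfolding psi_def by (intro sum_mono2 mangoldt_nonneg) (auto intro!: nat_mono floor_mono)

lemma card_multiples: "d > 0 \<Longrightarrow> card {k\<in>{1..n}. d dvd k} = n div (d::nat)"
proof -
  assume d: "d > 0"
  have "{k\<in>{1..n}. d dvd k} = (\<lambda>i. i * d) ` {1..n div d}"
  proof safe
    fix k assume k: "k \<in> {1..n}" "d dvd k"
    then obtain i where i: "k = i * d" by (auto elim!: dvdE simp: mult.commute)
    have "i \<le> n div d" using k i d by (metis atLeastAtMost_iff div_le_mono nonzero_mult_div_cancel_right less_numeral_extra(3))
    thus "k \<in> (\<lambda>i. i * d) ` {1..n div d}" using i k by (auto intro!: imageI Suc_leI Nat.gr0I)
  next
    fix i assume "i \<in> {1..n div d}"
    thus "i * d \<in> {1..n}" using d by (auto simp: less_eq_div_iff_mult_less_eq)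
  qed auto
  also have "card \<dots> = n div d"
    using d by (subst card_image) (auto simp: inj_on_def)
  finally show ?thesis .
qed

text \<open>
  Legendre's formula. The range of summation may be larger than $n$, since the additional quotients are $0$; this allows
  formulas for different $n$ to be combined termwise.
\<close>
lemma ln_fact_eq_sum_mangoldt:
  assumes "n \<le> N"
  shows "ln (fact n) = (\<Sum>d\<in>{1..N}. mangoldt d * real (n div d))"
proof -
  have "ln (fact n :: real) = (\<Sum>k\<in>{1..n}. ln (real k))"
    unfolding fact_prod by (subst of_nat_prod, subst ln_prod) auto
  also have "\<dots> = (\<Sum>k\<in>{1..n}. \<Sum>d | d dvd k. mangoldt d)"
    using mangoldt_sum[where ?'a=real] by (intro sum.cong) auto
  also have "\<dots> = (\<Sum>k\<in>{1..n}. \<Sum>d | d \<in> {1..N} \<and> d dvd k. mangoldt d)"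
    using assms by (intro sum.cong refl arg_cong2[where f=sum]) (auto dest: dvd_imp_le intro!: Nat.gr0I)
  also have "\<dots> = (\<Sum>d\<in>{1..N}. \<Sum>k | k \<in> {1..n} \<and> d dvd k. mangoldt d)"
    by (rule sum.swap_restrict) auto
  also have "\<dots> = (\<Sum>d\<in>{1..N}. mangoldt d * real (n div d))"
  proof (intro sum.cong refl)
    fix d assume "d \<in> {1..N}"
    hence "card {k\<in>{1..n}. d dvd k} = n div d" by (intro card_multiples) auto
    thus "(\<Sum>k | k \<in> {1..n} \<and> d dvd k. mangoldt d) = mangoldt d * real (n div d)" by (simp add: mult.commute)
  qed
  finally show ?thesis .
qed

text \<open>
  From $\ln {2n \choose n} = \sum_d \Lambda(d) (\lfloor 2n/d \rfloor - 2 \lfloor n/d \rfloor)$, where all coefficients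
  are nonnegative and those with $n < d \le 2n$ equal $1$.
\<close>
lemma psi_double: "psi (real (2 * n)) - psi (real n) \<le> 2 * real n * ln 2"
proof -
  have "psi (real (2 * n)) - psi (real n) = (\<Sum>d\<in>{1..2*n} - {1..n}. mangoldt d)"
    unfolding psi_def by (subst sum_diff) (auto simp del: of_nat_mult)
  also have "\<dots> = (\<Sum>d\<in>{1..2*n}. mangoldt d * (if d > n then 1 else 0))"
    by (rule sum.mono_neutral_cong_left) auto
  also have "\<dots> \<le> (\<Sum>d\<in>{1..2*n}. mangoldt d * (real (2*n div d) - 2 * real (n div d)))"
  proof (intro sum_mono mult_left_mono mangoldt_nonneg)
    fix d assume d: "d \<in> {1..2*n}"
    have "2 * (n div d) \<le> 2 * n div d" 
      using d by (simp add: less_eq_div_iff_mult_less_eq)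
    hence 1: "2 * real (n div d) \<le> real (2 * n div d)" by linarith
    have 2: "2 * n div d \<ge> 1" using d by (simp add: less_eq_div_iff_mult_less_eq)
    show "(if d > n then 1 else 0) \<le> real (2*n div d) - 2 * real (n div d)"
      using 1 2 by auto
  qed
  also have "\<dots> = ln (fact (2*n)) - 2 * ln (fact n)"
    using ln_fact_eq_sum_mangoldt[of "2*n" "2*n"] ln_fact_eq_sum_mangoldt[of "n" "2*n"]
    by (simp add: right_diff_distrib sum_subtractf sum_distrib_left mult_ac)
  also have "\<dots> = ln (real ((2*n) choose n))"
    by (simp add: binomial_fact ln_div ln_mult)
  also have "\<dots> \<le> ln (2 ^ (2 * n))"
  proof -
    have "(2*n) choose n \<le> 2 ^ (2*n)" by (rule binomial_le_pow2)
    hence "real ((2*n) choose n) \<le> 2 ^ (2*n)" by (metis of_nat_le_iff of_nat_numeral of_nat_power)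
    thus ?thesis by (subst ln_le_cancel_iff) auto
  qed
  finally show ?thesis by (simp add: ln_realpow)
qed

lemma psi_pow2: "psi (2 ^ k) \<le> 2 ^ (k+1) * ln 2"
proof (induction k)
  case 0
  show ?case by (simp add: psi_def)
next
  case (Suc k)
  show ?case using psi_double[of "2^k"] Suc by simp
qed

lemma psi_le:
  assumes "x \<ge> 0"
  shows "psi x \<le> 4 * x"
proof (cases "x < 1")
  case True
  thus ?thesis using assms by (simp add: psi_def)
next
  case False
  define N where "N = nat \<lfloor>x\<rfloor>"
  have N: "N \<ge> 1" "real N \<le> x" using False by (auto simp: N_def le_nat_floor)
  obtain k where k: "2 ^ k \<le> N" "N < 2 ^ (k + 1)" using ex_power_ivl1[of 2 N] N by auto
  have "real N < 2 ^ (k+1)" using k(2) by (metis of_nat_less_iff of_nat_numeral of_nat_power)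
  hence "N \<le> nat \<lfloor>2 ^ (k+1) :: real\<rfloor>" by (intro le_nat_floor) simp
  hence "psi x \<le> psi (2 ^ (k+1))"
    unfolding psi_def N_def[symmetric] by (intro sum_mono2 mangoldt_nonneg) auto
  also have "\<dots> \<le> 2 ^ (k + 2) * ln 2" using psi_pow2[of "k+1"] by simp
  also have "\<dots> \<le> 2 ^ (k + 2) * 1" using ln_le_minus_one[of "2::real"] by (intro mult_left_mono) auto
  also have "\<dots> = 4 * real (2 ^ k)" by simp
  also have "\<dots> \<le> 4 * real N" using k(1) by (intro mult_left_mono of_nat_mono) simp_all
  also have "\<dots> \<le> 4 * x" using N by simp
  finally show ?thesis .
qed

lemma prime_pi_eq_card: "prime_pi x = card {p\<in>{1..nat \<lfloor>x\<rfloor>}. prime p}"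
proof -
  have "{p. prime p \<and> real p \<le> x} = {p\<in>{1..nat \<lfloor>x\<rfloor>}. prime p}"
  proof safe
    fix p :: nat assume p: "prime p"
    { assume "real p \<le> x"
      thus "p \<in> {1..nat \<lfloor>x\<rfloor>}" using prime_gt_0_nat[OF p] by (auto simp: le_nat_floor) }
    assume "p \<in> {1..nat \<lfloor>x\<rfloor>}"
    hence "1 \<le> p" "p \<le> nat \<lfloor>x\<rfloor>" by auto
    thus "real p \<le> x" by linarith
  qed
  thus ?thesis by (simp add: prime_pi_def)
qed

text \<open>
  Each prime $p \le x$ contributes $\lfloor \ln x / \ln p \rfloor \ln p \le \ln x$ to $\psi(x)$.
\<close>
lemma psi_le_prime_pi_ln:
  assumes x: "x \<ge> 1"
  shows "psi x \<le> real (prime_pi x) * ln x"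
proof -
  define N where "N = nat \<lfloor>x\<rfloor>"
  define S where "S = {d\<in>{1..N}. primepow d}"
  define P where "P = {p\<in>{1..N}. prime p}"
  have N: "real N \<le> x" using x by (auto simp: N_def)
  have "psi x = (\<Sum>d\<in>S. ln (real (aprimedivisor d)))"
    unfolding psi_def N_def[symmetric] S_def by (rule sum.mono_neutral_cong_right) (auto simp: mangoldt_def)
  also have "\<dots> = (\<Sum>p\<in>P. \<Sum>d\<in>{d\<in>S. aprimedivisor d = p}. ln (real (aprimedivisor d)))"
  proof (rule sum.group [symmetric])
    show "aprimedivisor ` S \<subseteq> P"
    proof safe
      fix d assume d: "d \<in> S"
      then obtain p k where pk: "prime p" "k > 0" "d = p ^ k" by (auto simp: S_def primepow_def)
      have "p \<le> d" using pk by (metis dvd_imp_le dvd_power prime_gt_0_nat zero_less_power)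
      thus "aprimedivisor d \<in> P"
        using d pk by (auto simp: aprimedivisor_prime_power P_def S_def prime_ge_1_nat prime_gt_0_nat Suc_le_eq)
    qed
  qed (auto simp: S_def P_def)
  also have "\<dots> \<le> (\<Sum>p\<in>P. ln x)"
  proof (rule sum_mono)
    fix p assume p: "p \<in> P"
    hence pp: "prime p" by (simp add: P_def)
    have lnp: "ln (real p) > 0" using prime_gt_1_nat[OF pp] by simp
    define K where "K = nat \<lfloor>ln x / ln (real p)\<rfloor>"
    have "{d\<in>S. aprimedivisor d = p} \<subseteq> (\<lambda>k. p ^ k) ` {1..K}"
    proof safe
      fix d assume d: "d \<in> S" "p = aprimedivisor d"
      then obtain q k where qk: "prime q" "k > 0" "d = q ^ k" by (auto simp: S_def primepow_def)
      hence q: "q = aprimedivisor d" by (simp add: aprimedivisor_prime_power)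
      have "real q ^ k \<le> x" using N d qk by (auto simp: S_def simp flip: of_nat_power)
      hence "ln (real q ^ k) \<le> ln x" using prime_gt_0_nat[OF qk(1)] x by (subst ln_le_cancel_iff) auto
      hence "real k * ln (real p) \<le> ln x" using prime_gt_0_nat[OF qk(1)] d(2) q by (simp add: ln_realpow)
      hence "real k \<le> ln x / ln (real p)" using lnp by (simp add: field_simps)
      hence "k \<le> K" unfolding K_def by (simp add: le_nat_floor)
      moreover have "d = aprimedivisor d ^ k" unfolding q[symmetric] by (rule qk)
      ultimately show "d \<in> power (aprimedivisor d) ` {1..K}" using qk(2) by (intro image_eqI[of _ _ k]) simp_all
    qed
    hence "card {d\<in>S. aprimedivisor d = p} \<le> card ((\<lambda>k. p ^ k) ` {1..K})" by (intro card_mono) auto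
    also have "\<dots> \<le> K" using card_image_le[of "{1..K}" "\<lambda>k. p ^ k"] by simp
    finally have "real (card {d\<in>S. aprimedivisor d = p}) \<le> real K" by simp
    also have "\<dots> \<le> ln x / ln (real p)" unfolding K_def using x lnp by (intro of_nat_floor) auto
    finally have "real (card {d\<in>S. aprimedivisor d = p}) * ln (real p) \<le> ln x" using lnp by (simp add: field_simps)
    thus "(\<Sum>d\<in>{d\<in>S. aprimedivisor d = p}. ln (real (aprimedivisor d))) \<le> ln x" by simp
  qed
  finally show ?thesis by (simp add: P_def N_def prime_pi_eq_card)
qed

text \<open>
  Each prime $p$ with $\sqrt n < p \le n$ contributes $\ln p \ge \frac12 \ln n$ to $\psi(n) \le 4n$.
\<close>
lemma prime_pi_upper:
  assumes n: "n > (1::nat)"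
  shows "real (prime_pi (real n)) \<le> sqrt (real n) + 8 * real n / ln (real n)"
proof -
  define P where "P = {p\<in>{1..n}. prime p}"
  define A where "A = {p\<in>P. real p \<le> sqrt (real n)}"
  define B where "B = {p\<in>P. real p > sqrt (real n)}"
  have fin: "finite P" "finite A" "finite B" by (auto simp: P_def A_def B_def)
  have lnn: "ln (real n) > 0" using n by simp
  have "card P = card A + card B" using fin
    by (subst card_Un_disjoint [symmetric]) (auto simp: A_def B_def intro!: arg_cong[where f=card])
  moreover have "real (card A) \<le> sqrt (real n)"
  proof -
    have "A \<subseteq> {1..nat \<lfloor>sqrt (real n)\<rfloor>}" by (auto simp: A_def P_def le_nat_floor)
    hence "card A \<le> nat \<lfloor>sqrt (real n)\<rfloor>" using card_mono[of "{1..nat \<lfloor>sqrt (real n)\<rfloor>}" A] by simp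
    thus ?thesis by (simp add: le_nat_iff le_floor_iff)
  qed
  moreover have "real (card B) \<le> 8 * real n / ln (real n)"
  proof -
    have "real (card B) * (ln (real n) / 2) = (\<Sum>p\<in>B. ln (sqrt (real n)))"
      using n by (simp add: ln_sqrt)
    also have "\<dots> \<le> (\<Sum>p\<in>B. mangoldt p)"
    proof (rule sum_mono)
      fix p assume p: "p \<in> B"
      hence "ln (sqrt (real n)) \<le> ln (real p)" using n by (subst ln_le_cancel_iff) (auto simp: B_def P_def)
      thus "ln (sqrt (real n)) \<le> mangoldt p" using p by (simp add: B_def P_def)
    qed
    also have "\<dots> \<le> psi (real n)"
      unfolding psi_def by (rule sum_mono2) (auto simp: B_def P_def mangoldt_nonneg)
    also have "\<dots> \<le> 4 * real n" by (rule psi_le) auto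
    finally show ?thesis using lnn by (simp add: field_simps)
  qed
  ultimately show ?thesis by (simp add: prime_pi_eq_card P_def)
qed

section \<open>Exponential integrals, the Fejer kernel and the Riemann--Lebesgue lemma\<close>

lemma integrable_exp_Ici:
  assumes "\<sigma> > (0::real)"
  shows "integrable lborel (\<lambda>u. indicator {0..} u * exp (-(\<sigma> * u)))"
proof -
  have "integrable lborel (\<lambda>x::real. exp (-x) * indicator {0..} x)"
    using has_bochner_integral_I0i_power_exp_m'[of 0] by (simp add: has_bochner_integral_iff)
  from lborel_integrable_real_affine[OF this, of \<sigma> 0] show ?thesis using assms
    by (simp add: indicator_def zero_le_mult_iff mult.commute cong: if_cong)
qed

lemma has_bochner_integral_exp_0:
  assumes s: "Re s > 0"
  shows "has_bochner_integral lborel (\<lambda>u. indicator {0..} u *\<^sub>R exp (-(s * of_real u))) (1 / s)"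
proof -
  have s0: "s \<noteq> 0" using s by auto
  define f where "f = (\<lambda>u. indicator {0..} u *\<^sub>R exp (-(s * complex_of_real u)))"
  define w where "w = (\<lambda>u. indicator {0..} u * exp (-(Re s * u)))"
  have [measurable]: "f \<in> borel_measurable lborel" unfolding f_def by measurable
  have w: "integrable lborel w" unfolding w_def by (rule integrable_exp_Ici[OF s])
  have nf: "norm (f u) = w u" for u by (auto simp: f_def w_def indicator_def)
  have int: "integrable lborel f"
    by (rule Bochner_Integration.integrable_bound[OF w]) (auto simp: nf)
  have "((\<lambda>T. LINT u|lborel. indicator {0..T} u *\<^sub>R exp (-(s * of_real u))) \<longlongrightarrow> integral\<^sup>L lborel f) at_top"
  proof (rule integral_dominated_convergence_at_top[OF _ _ w])
    show "AE u in lborel. ((\<lambda>T. indicator {0..T} u *\<^sub>R exp (-(s * complex_of_real u))) \<longlongrightarrow> f u) at_top"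
    proof (rule AE_I2)
      fix u :: real
      have "\<forall>\<^sub>F T in at_top. f u = indicator {0..T} u *\<^sub>R exp (-(s * complex_of_real u))"
        using eventually_ge_at_top[of u] by eventually_elim (auto simp: f_def indicator_def)
      thus "((\<lambda>T. indicator {0..T} u *\<^sub>R exp (-(s * complex_of_real u))) \<longlongrightarrow> f u) at_top"
        by (rule Lim_transform_eventually[OF tendsto_const])
    qed
    show "\<forall>\<^sub>F T in at_top. AE u in lborel. norm (indicator {0..T} u *\<^sub>R exp (-(s * complex_of_real u))) \<le> w u"
      by (intro always_eventually allI AE_I2) (auto simp: w_def indicator_def)
  qed auto
  moreover have "\<forall>\<^sub>F T in at_top. (LINT u|lborel. indicator {0..T} u *\<^sub>R exp (-(s * of_real u))) = (1 - exp (-(s * of_real T))) / s"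
    using eventually_ge_at_top[of 0]
  proof eventually_elim
    case (elim T)
    have "(LINT u|lborel. indicator {0..T} u *\<^sub>R exp (-(s * of_real u))) = (- exp (-(s * of_real T)) / s) - (- exp (-(s * of_real 0)) / s)"
    proof (rule integral_FTC_Icc[OF elim, where F="\<lambda>u. - exp (-(s * of_real u)) / s"])
      fix u :: real
      have "((\<lambda>z. - exp (-(s * z)) / s) has_field_derivative exp (-(s * of_real u))) (at (of_real u))"
        using s0 by (auto intro!: derivative_eq_intros)
      thus "((\<lambda>u. - exp (-(s * of_real u)) / s) has_vector_derivative exp (-(s * of_real u))) (at u within {0..T})"
        using has_vector_derivative_real_field has_vector_derivative_at_within by blast
    qed (intro continuous_intros)
    thus ?case using s0 by (simp add: field_simps)
  qed
  ultimately have L1: "((\<lambda>T. (1 - exp (-(s * complex_of_real T))) / s) \<longlongrightarrow> integral\<^sup>L lborel f) at_top"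
    by (rule Lim_transform_eventually)
  have "((\<lambda>T. exp (-(s * complex_of_real T))) \<longlongrightarrow> 0) at_top"
  proof (rule tendsto_norm_zero_cancel)
    have "((\<lambda>T. exp (-(Re s * T))) \<longlongrightarrow> 0) at_top" using s by real_asymp
    thus "((\<lambda>T. norm (exp (-(s * complex_of_real T)))) \<longlongrightarrow> 0) at_top" by simp
  qed
  hence "((\<lambda>T. (1 - exp (-(s * complex_of_real T))) / s) \<longlongrightarrow> (1 - 0) / s) at_top"
    using s0 by (intro tendsto_intros)
  from tendsto_unique[OF trivial_limit_at_top_linorder L1 this] have "integral\<^sup>L lborel f = 1 / s"
    by simp
  thus ?thesis using int unfolding f_def by (simp add: has_bochner_integral_iff)
qed

lemma has_bochner_integral_exp_Ici:
  assumes s: "Re s > 0"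
  shows "has_bochner_integral lborel (\<lambda>u. indicator {a..} u *\<^sub>R exp (-(s * of_real u))) (exp (-(s * of_real a)) / s)"
proof -
  have "has_bochner_integral lborel (\<lambda>u. exp (-(s * of_real a)) * (indicator {0..} (-a + 1 * u) *\<^sub>R exp (-(s * of_real (-a + 1 * u))))) (exp (-(s * of_real a)) * (1 / s))"
    using lborel_has_bochner_integral_real_affine_iff[THEN iffD1, OF _ has_bochner_integral_exp_0[OF s], of 1 "-a"]
    by (intro has_bochner_integral_mult_right) auto
  moreover have "exp (-(s * of_real a)) * (indicator {0..} (-a + 1 * u) *\<^sub>R exp (-(s * of_real (-a + 1 * u)))) = indicator {a..} u *\<^sub>R exp (-(s * of_real u))" for u
    by (auto simp: indicator_def algebra_simps simp flip: exp_add)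
  ultimately show ?thesis by simp
qed

text \<open>
  The triangle function; it is the compactly supported Fourier transform (up to scaling) of the kernel below.
\<close>
definition triangle :: "real \<Rightarrow> real" where "triangle t = max 0 (1 - \<bar>t\<bar>)"

text \<open>
  The Fejer kernel $2 (1 - \cos v)/v^2$, written as a square. It is not normalised to have integral $1$.
\<close>
definition fejer :: "real \<Rightarrow> real" where "fejer v = (if v = 0 then 1 else (sin (v / 2) / (v / 2))\<^sup>2)"

lemma triangle_measurable [measurable]: "triangle \<in> borel_measurable borel"
  unfolding triangle_def by measurable

lemma fejer_measurable [measurable]: "fejer \<in> borel_measurable borel"
proof -
  have "fejer = (\<lambda>v. if v \<in> {0} then 1 else (sin (v / 2) / (v / 2))\<^sup>2)"
    by (rule ext) (simp add: fejer_def)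
  moreover have "\<dots> \<in> borel_measurable borel" by measurable
  ultimately show ?thesis by (simp only:)
qed

lemma triangle_bounds: "triangle t \<ge> 0" "triangle t \<le> indicator {-1..1} t" "\<bar>t\<bar> \<ge> 1 \<Longrightarrow> triangle t = 0"
  by (auto simp: triangle_def indicator_def)

lemma integrable_triangle: "integrable lborel triangle"
  by (rule Bochner_Integration.integrable_bound[where f="indicator {-1..1} :: real \<Rightarrow> real"])
     (auto simp: triangle_def indicator_def)

lemma fejer_nonneg: "fejer v \<ge> 0"
  by (simp add: fejer_def)

lemma fejer_le: "fejer v \<le> 5 * inverse (1 + v\<^sup>2)"
proof (cases "v = 0")
  case False
  have 1: "fejer v \<le> 1"
  proof -
    have "\<bar>sin (v / 2) / (v / 2)\<bar> \<le> 1" using abs_sin_x_le_abs_x[of "v/2"] False by (simp add: field_simps)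
    thus ?thesis using False by (simp add: fejer_def abs_square_le_1)
  qed
  have 2: "v\<^sup>2 * fejer v \<le> 4"
  proof -
    have "v\<^sup>2 * fejer v = 4 * (sin (v/2))\<^sup>2" using False by (simp add: fejer_def power_divide)
    also have "\<dots> \<le> 4 * 1" by (intro mult_left_mono) (auto simp: abs_square_le_1)
    finally show ?thesis by simp
  qed
  have "(1 + v\<^sup>2) * fejer v \<le> 5" using 1 2 by (simp add: algebra_simps)
  moreover have "1 + v\<^sup>2 > 0" by (simp add: add_pos_nonneg)
  ultimately show ?thesis by (simp add: field_simps)
qed (auto simp: fejer_def)

lemma integrable_fejer: "integrable lborel fejer"
proof (rule Bochner_Integration.integrable_bound)
  show "integrable lborel (\<lambda>v::real. 5 * inverse (1 + v\<^sup>2))"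
    using integrable_inverse_1_plus_square by (simp add: set_integrable_def einterval_eq)
  show "AE x in lborel. norm (fejer x) \<le> norm (5 * inverse (1 + x\<^sup>2))"
    using fejer_le fejer_nonneg by (intro AE_I2) (smt (verit) real_norm_def)
qed auto

lemma integral_fejer_pos: "(LINT v|lborel. fejer v) > 0"
proof -
  have "(LINT v|lborel. fejer v) \<noteq> 0"
  proof
    assume "(LINT v|lborel. fejer v) = 0"
    hence ae: "AE v in lborel. fejer v = 0"
      using integral_nonneg_eq_0_iff_AE[OF integrable_fejer] fejer_nonneg by auto
    have nz: "fejer v \<noteq> 0" if "v \<in> {0<..<1}" for v
    proof -
      have "sin (v/2) > 0" using that pi_gt3 by (intro sin_gt_zero) auto
      thus ?thesis using that by (simp add: fejer_def)
    qed
    have "AE v in lborel. \<not> (v \<in> {0<..<1::real})"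
      using ae by (rule eventually_mono) (use nz in blast)
    hence "emeasure lborel {v\<in>space lborel. v \<in> {0<..<1::real}} = 0" by (rule emeasure_eq_0_AE)
    also have "{v\<in>space lborel. v \<in> {0<..<1::real}} = {0<..<1}" by auto
    finally show False by simp
  qed
  moreover have "(LINT v|lborel. fejer v) \<ge> 0" using fejer_nonneg by simp
  ultimately show ?thesis by simp
qed

lemma integral_triangle_exp:
  assumes v: "v \<noteq> 0"
  shows "(LINT t|lborel. of_real (triangle t) * exp (\<i> * of_real (t * v))) = of_real (fejer v)"
proof -
  define c where "c = \<i> * complex_of_real v"
  have c: "c \<noteq> 0" using v by (simp add: c_def)
  define f1 where "f1 = (\<lambda>t::real. (1 + of_real t) * exp (c * of_real t))"
  define f2 where "f2 = (\<lambda>t::real. (1 - of_real t) * exp (c * of_real t))"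
  have 1: "has_bochner_integral lborel (\<lambda>t. indicator {-1..0} t *\<^sub>R f1 t) 
     (((1 + of_real 0) * exp (c * of_real 0) / c - exp (c * of_real 0) / c\<^sup>2) - ((1 + of_real (-1)) * exp (c * of_real (-1)) / c - exp (c * of_real (-1)) / c\<^sup>2))"
  proof (rule has_bochner_integral_FTC_Icc[where F="\<lambda>t. (1 + of_real t) * exp (c * of_real t) / c - exp (c * of_real t) / c\<^sup>2"])
    fix t :: real
    have "((\<lambda>z. (1 + z) * exp (c * z) / c - exp (c * z) / c\<^sup>2) has_field_derivative f1 t) (at (of_real t))"
      unfolding f1_def using c by (auto intro!: derivative_eq_intros simp: field_simps power2_eq_square)
    thus "((\<lambda>t. (1 + of_real t) * exp (c * of_real t) / c - exp (c * of_real t) / c\<^sup>2) has_vector_derivative f1 t) (at t within {-1..0})"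
      using has_vector_derivative_real_field has_vector_derivative_at_within by blast
  qed (auto simp: f1_def intro!: continuous_intros)
  have 2: "has_bochner_integral lborel (\<lambda>t. indicator {0..1} t *\<^sub>R f2 t) 
     (((1 - of_real 1) * exp (c * of_real 1) / c + exp (c * of_real 1) / c\<^sup>2) - ((1 - of_real 0) * exp (c * of_real 0) / c + exp (c * of_real 0) / c\<^sup>2))"
  proof (rule has_bochner_integral_FTC_Icc[where F="\<lambda>t. (1 - of_real t) * exp (c * of_real t) / c + exp (c * of_real t) / c\<^sup>2"])
    fix t :: real
    have "((\<lambda>z. (1 - z) * exp (c * z) / c + exp (c * z) / c\<^sup>2) has_field_derivative f2 t) (at (of_real t))"
      unfolding f2_def using c by (auto intro!: derivative_eq_intros simp: field_simps power2_eq_square)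
    thus "((\<lambda>t. (1 - of_real t) * exp (c * of_real t) / c + exp (c * of_real t) / c\<^sup>2) has_vector_derivative f2 t) (at t within {0..1})"
      using has_vector_derivative_real_field has_vector_derivative_at_within by blast
  qed (auto simp: f2_def intro!: continuous_intros)
  have 3: "(LINT t|lborel. of_real (triangle t) * exp (\<i> * of_real (t * v))) = (LINT t|lborel. indicator {-1..0} t *\<^sub>R f1 t + indicator {0..1} t *\<^sub>R f2 t)"
  proof (rule integral_cong_AE)
    show "AE t in lborel. of_real (triangle t) * exp (\<i> * of_real (t * v)) = indicator {-1..0} t *\<^sub>R f1 t + indicator {0..1} t *\<^sub>R f2 t"
      using AE_lborel_singleton[of 0]
      by eventually_elim (auto simp: triangle_def indicator_def f1_def f2_def c_def mult_ac max_def)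
    show "(\<lambda>t. indicator {-1..0} t *\<^sub>R f1 t + indicator {0..1} t *\<^sub>R f2 t) \<in> borel_measurable lborel"
      unfolding f1_def f2_def by measurable
  qed measurable
  also have "\<dots> = (((1 + of_real 0) * exp (c * of_real 0) / c - exp (c * of_real 0) / c\<^sup>2) - ((1 + of_real (-1)) * exp (c * of_real (-1)) / c - exp (c * of_real (-1)) / c\<^sup>2)) +
     (((1 - of_real 1) * exp (c * of_real 1) / c + exp (c * of_real 1) / c\<^sup>2) - ((1 - of_real 0) * exp (c * of_real 0) / c + exp (c * of_real 0) / c\<^sup>2))"
    using has_bochner_integral_add[OF 1 2] by (rule has_bochner_integral_integral_eq)
  also have "\<dots> = (exp c + exp (-c) - 2) / c\<^sup>2"
    by (simp add: add_divide_distrib diff_divide_distrib)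
  also have "exp c + exp (-c) = of_real (2 * cos v)"
    unfolding c_def by (simp add: exp_Euler[symmetric] cos_exp_eq cos_of_real [symmetric] exp_minus)
  also have "(of_real (2 * cos v) - 2) / c\<^sup>2 = of_real ((2 - 2 * cos v) / v\<^sup>2)"
    using v by (simp add: c_def power_mult_distrib field_simps)
  also have "(2 - 2 * cos v) / v\<^sup>2 = fejer v"
    using v cos_double_sin[of "v/2"] by (simp add: fejer_def power_divide field_simps)
  finally show ?thesis .
qed

text \<open>
  Shifting $t$ by the half period $\pi / y$ changes the sign of the exponential, so twice the integral is
  $\int (h(t) - h(t + \pi/y)) e^{ity}\, dt$, which tends to $0$ by continuity of $h$.
\<close>
lemma riemann_lebesgue:
  fixes h :: "real \<Rightarrow> complex"
  assumes h: "continuous_on UNIV h" and h0: "\<And>t. \<bar>t\<bar> \<ge> 1 \<Longrightarrow> h t = 0"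
  shows "((\<lambda>y. LINT t|lborel. h t * exp (\<i> * of_real (t * y))) \<longlongrightarrow> 0) at_top"
proof -
  have hm [measurable]: "h \<in> borel_measurable borel" using h by (rule borel_measurable_continuous_onI)
  have "compact (h ` {-1..1})" using h by (intro compact_continuous_image continuous_on_subset[OF h]) auto
  then obtain M0 where M0: "\<And>t. t \<in> {-1..1} \<Longrightarrow> norm (h t) \<le> M0"
    using compact_imp_bounded[of "h ` {-1..1}"] unfolding bounded_iff by blast
  define M where "M = max 0 M0"
  have M: "norm (h t) \<le> M" for t
  proof (cases "\<bar>t\<bar> \<ge> 1")
    case False
    hence "t \<in> {-1..1}" by auto
    thus ?thesis using M0[of t] by (auto simp: M_def)
  qed (use h0[of t] in \<open>auto simp: M_def\<close>)
  have Mnn: "M \<ge> 0" by (simp add: M_def)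
  define I where "I = (\<lambda>y. LINT t|lborel. h t * exp (\<i> * of_real (t * y)))"
  have inth: "integrable lborel (\<lambda>t. h t * exp (\<i> * of_real (t * y)))" for y
  proof (rule Bochner_Integration.integrable_bound)
    show "integrable lborel (\<lambda>t. M * indicator {-1..1::real} t)" by auto
    show "AE t in lborel. norm (h t * exp (\<i> * of_real (t * y))) \<le> norm (M * indicator {-1..1::real} t)"
      using M h0 Mnn by (intro AE_I2) (auto simp: norm_mult indicator_def not_le abs_le_iff abs_less_iff)
  qed measurable
  have eq: "2 * I y = (LINT t|lborel. (h t - h (t + pi / y)) * exp (\<i> * of_real (t * y)))" if y: "y > 0" for y
  proof -
    have "I y = (LINT t|lborel. h (pi / y + 1 * t) * exp (\<i> * of_real ((pi / y + 1 * t) * y)))"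
      unfolding I_def by (subst lborel_integral_real_affine[of 1 _ "pi / y"]) auto
    also have "\<dots> = (LINT t|lborel. - (h (t + pi / y) * exp (\<i> * of_real (t * y))))"
    proof (intro Bochner_Integration.integral_cong refl)
      fix t
      have "(pi / y + 1 * t) * y = pi + t * y" using y by (simp add: field_simps)
      hence "exp (\<i> * of_real ((pi / y + 1 * t) * y)) = exp (\<i> * of_real pi) * exp (\<i> * of_real (t * y))"
        by (simp add: distrib_left exp_add)
      thus "h (pi / y + 1 * t) * exp (\<i> * of_real ((pi / y + 1 * t) * y)) = - (h (t + pi / y) * exp (\<i> * of_real (t * y)))"
        by (simp add: add.commute)
    qed
    finally have 1: "I y = (LINT t|lborel. - (h (t + pi / y) * exp (\<i> * of_real (t * y))))" .
    have "integrable lborel (\<lambda>t. h (pi / y + 1 * t) * exp (\<i> * of_real ((pi / y + 1 * t) * y)))"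
      by (rule lborel_integrable_real_affine[OF inth]) simp
    hence "integrable lborel (\<lambda>t. exp (\<i> * of_real (- pi)) * (h (pi / y + 1 * t) * exp (\<i> * of_real ((pi / y + 1 * t) * y))))"
      by (rule integrable_mult_right)
    also have "(\<lambda>t. exp (\<i> * of_real (- pi)) * (h (pi / y + 1 * t) * exp (\<i> * of_real ((pi / y + 1 * t) * y)))) = 
        (\<lambda>t. h (t + pi / y) * exp (\<i> * of_real (t * y)))"
    proof
      fix t
      have "(pi / y + 1 * t) * y = pi + t * y" using y by (simp add: field_simps)
      thus "exp (\<i> * of_real (- pi)) * (h (pi / y + 1 * t) * exp (\<i> * of_real ((pi / y + 1 * t) * y))) = h (t + pi / y) * exp (\<i> * of_real (t * y))"
        by (simp add: distrib_left exp_add add.commute exp_minus)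
    qed
    finally have 2: "integrable lborel (\<lambda>t. - (h (t + pi / y) * exp (\<i> * of_real (t * y))))" by simp
    have "2 * I y = I y + I y" by simp
    also have "\<dots> = (LINT t|lborel. h t * exp (\<i> * of_real (t * y)) + - (h (t + pi / y) * exp (\<i> * of_real (t * y))))"
      unfolding Bochner_Integration.integral_add[OF inth 2]
      by (rule arg_cong2[where f="(+)"]) (simp only: I_def, rule 1)
    also have "(\<lambda>t. h t * exp (\<i> * of_real (t * y)) + - (h (t + pi / y) * exp (\<i> * of_real (t * y)))) =
       (\<lambda>t. (h t - h (t + pi / y)) * exp (\<i> * of_real (t * y)))"
      by (rule ext) (simp add: left_diff_distrib)
    finally show ?thesis .
  qed
  have "((\<lambda>y. LINT t|lborel. (h t - h (t + pi / y)) * exp (\<i> * of_real (t * y))) \<longlongrightarrow> (LINT (t::real)|lborel. (0::complex))) at_top"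
  proof (rule integral_dominated_convergence_at_top)
    show "integrable lborel (\<lambda>t. 2 * M * indicator {-2..1::real} t)" by auto
    show "AE t in lborel. ((\<lambda>y. (h t - h (t + pi / y)) * exp (\<i> * of_real (t * y))) \<longlongrightarrow> 0) at_top"
    proof (rule AE_I2)
      fix t :: real
      have "((\<lambda>y. t + pi / y) \<longlongrightarrow> t) at_top" by real_asymp
      moreover have "isCont h t" using h by (simp add: continuous_on_eq_continuous_at)
      ultimately have "((\<lambda>y. h (t + pi / y)) \<longlongrightarrow> h t) at_top" by (metis isCont_tendsto_compose)
      hence "((\<lambda>y. h t - h (t + pi / y)) \<longlongrightarrow> h t - h t) at_top" by (intro tendsto_intros)
      hence "((\<lambda>y. norm ((h t - h (t + pi / y)) * exp (\<i> * of_real (t * y)))) \<longlongrightarrow> 0) at_top"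
        by (simp add: norm_mult tendsto_norm_zero)
      thus "((\<lambda>y. (h t - h (t + pi / y)) * exp (\<i> * of_real (t * y))) \<longlongrightarrow> 0) at_top" by (rule tendsto_norm_zero_cancel)
    qed
    show "\<forall>\<^sub>F y in at_top. AE t in lborel. norm ((h t - h (t + pi / y)) * exp (\<i> * of_real (t * y))) \<le> 2 * M * indicator {-2..1::real} t"
      using eventually_ge_at_top[of pi]
    proof eventually_elim
      case (elim y)
      have "y > 0" using elim pi_gt_zero by linarith
      hence d: "0 < pi / y" "pi / y \<le> 1" using elim by auto
      show ?case
      proof (rule AE_I2)
        fix t :: real
        show "norm ((h t - h (t + pi / y)) * exp (\<i> * of_real (t * y))) \<le> 2 * M * indicator {-2..1::real} t"
        proof (cases "t \<in> {-2..1}")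
          case True
          have "norm (h t - h (t + pi / y)) \<le> M + M" by (intro order.trans[OF norm_triangle_ineq4] add_mono M)
          thus ?thesis using True by (simp add: norm_mult)
        next
          case False
          hence "h t = 0" "h (t + pi / y) = 0" using d by (auto intro!: h0 simp: abs_if)
          thus ?thesis using False by simp
        qed
      qed
    qed
  qed measurable
  hence "((\<lambda>y. (LINT t|lborel. (h t - h (t + pi / y)) * exp (\<i> * of_real (t * y))) / 2) \<longlongrightarrow> 0) at_top"
    by (intro tendsto_divide_zero) simp
  moreover have "\<forall>\<^sub>F y in at_top. (LINT t|lborel. (h t - h (t + pi / y)) * exp (\<i> * of_real (t * y))) / 2 = I y"
    using eventually_gt_at_top[of 0] by eventually_elim (simp only: eq[symmetric], simp)
  ultimately have "(I \<longlongrightarrow> 0) at_top" by (rule Lim_transform_eventually)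
  thus ?thesis by (simp add: I_def)
qed

section \<open>A Tauberian theorem\<close>

lemma fejer_shift_integrable:
  assumes "\<mu> > 0"
  shows "integrable lborel (\<lambda>u. fejer (\<mu> * (y - u)))"
  using lborel_integrable_real_affine[OF integrable_fejer, of "-\<mu>" "\<mu> * y"] assms
  by (simp add: algebra_simps)

text \<open>
  Fubini's theorem for $A(u) e^{-\epsilon u}$ times the Fourier integral of the Fejer kernel.
\<close>
lemma smoothed_laplace_identity:
  fixes A :: "real \<Rightarrow> real" and g :: "complex \<Rightarrow> complex"
  assumes [measurable]: "A \<in> borel_measurable borel"
    and bound: "\<And>u. \<bar>A u\<bar> \<le> C" and neg: "\<And>u. u < 0 \<Longrightarrow> A u = 0"
    and lap: "\<And>w. Re w > 0 \<Longrightarrow> (LINT u|lborel. of_real (A u) * exp (-(w * of_real u))) = g w"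
    and e: "\<epsilon> > 0" and l: "\<mu> > 0"
  shows "of_real (LINT u|lborel. A u * exp (-(\<epsilon> * u)) * fejer (\<mu> * (y - u))) 
     = (LINT t|lborel. of_real (triangle t) * g (of_real \<epsilon> + \<i> * of_real (\<mu> * t)) * exp (\<i> * of_real (t * (\<mu> * y))))"
proof -
  define F where "F = (\<lambda>u t. of_real (A u * exp (-(\<epsilon> * u))) * (complex_of_real (triangle t) * exp (\<i> * of_real (t * (\<mu> * (y - u))))))"
  have nF: "norm (F u t) = \<bar>A u\<bar> * exp (-(\<epsilon> * u)) * triangle t" for u t
    by (simp add: F_def norm_mult triangle_bounds abs_mult del: of_real_mult)
  have Fm [measurable]: "case_prod F \<in> borel_measurable (lborel \<Otimes>\<^sub>M lborel)"
    unfolding F_def by measurable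
  have intA: "integrable lborel (\<lambda>u. \<bar>A u\<bar> * exp (-(\<epsilon> * u)))"
  proof (rule Bochner_Integration.integrable_bound)
    show "integrable lborel (\<lambda>u. C * (indicator {0..} u * exp (-(\<epsilon> * u))))"
      by (intro integrable_mult_right integrable_exp_Ici e)
    show "AE u in lborel. norm (\<bar>A u\<bar> * exp (-(\<epsilon> * u))) \<le> norm (C * (indicator {0..} u * exp (-(\<epsilon> * u))))"
    proof (rule AE_I2)
      fix u
      have "\<bar>A u\<bar> \<le> \<bar>C\<bar>" using bound[of u] by simp
      thus "norm (\<bar>A u\<bar> * exp (-(\<epsilon> * u))) \<le> norm (C * (indicator {0..} u * exp (-(\<epsilon> * u))))"
        using neg[of u] by (cases "u < 0") (auto simp: abs_mult indicator_def)
    qed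
  qed measurable
  have int_t: "integrable lborel (F u)" for u
  proof (rule Bochner_Integration.integrable_bound)
    show "integrable lborel (\<lambda>t. \<bar>A u\<bar> * exp (-(\<epsilon> * u)) * triangle t)"
      by (intro integrable_mult_right integrable_triangle)
    show "F u \<in> borel_measurable lborel" unfolding F_def by measurable
    show "AE t in lborel. norm (F u t) \<le> norm (\<bar>A u\<bar> * exp (-(\<epsilon> * u)) * triangle t)"
      unfolding nF by (intro AE_I2) (simp add: abs_mult triangle_bounds)
  qed
  have intF: "integrable (lborel \<Otimes>\<^sub>M lborel) (case_prod F)"
  proof (rule lborel_pair.Fubini_integrable[OF Fm])
    show "AE u in lborel. integrable lborel (\<lambda>t. case_prod F (u, t))" using int_t by simp
    have "(\<lambda>u. LINT t|lborel. norm (case_prod F (u, t))) = (\<lambda>u. \<bar>A u\<bar> * exp (-(\<epsilon> * u)) * (LINT t|lborel. triangle t))"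
      by (simp add: nF)
    thus "integrable lborel (\<lambda>u. LINT t|lborel. norm (case_prod F (u, t)))"
      using intA by (simp only: integrable_mult_left)
  qed
  have "(LINT u|lborel. LINT t|lborel. F u t) = (LINT u|lborel. complex_of_real (A u * exp (-(\<epsilon> * u)) * fejer (\<mu> * (y - u))))"
  proof (rule integral_cong_AE)
    show "AE u in lborel. (LINT t|lborel. F u t) = complex_of_real (A u * exp (-(\<epsilon> * u)) * fejer (\<mu> * (y - u)))"
      using AE_lborel_singleton[of y]
    proof eventually_elim
      case (elim u)
      have "(LINT t|lborel. F u t) = of_real (A u * exp (-(\<epsilon> * u))) * (LINT t|lborel. complex_of_real (triangle t) * exp (\<i> * of_real (t * (\<mu> * (y - u)))))"
        unfolding F_def by (rule integral_mult_right_zero)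
      also have "(LINT t|lborel. complex_of_real (triangle t) * exp (\<i> * of_real (t * (\<mu> * (y - u))))) = of_real (fejer (\<mu> * (y - u)))"
        using elim l by (intro integral_triangle_exp) auto
      finally show ?case by simp
    qed
    show "(\<lambda>u. LINT t|lborel. F u t) \<in> borel_measurable lborel" using Fm by measurable
  qed measurable
  also have "\<dots> = of_real (LINT u|lborel. A u * exp (-(\<epsilon> * u)) * fejer (\<mu> * (y - u)))"
    by (rule integral_complex_of_real)
  finally have 1: "(LINT u|lborel. LINT t|lborel. F u t) = of_real (LINT u|lborel. A u * exp (-(\<epsilon> * u)) * fejer (\<mu> * (y - u)))" .
  have "(LINT u|lborel. LINT t|lborel. F u t) = (LINT t|lborel. LINT u|lborel. F u t)"
    using lborel_pair.Fubini_integral[OF intF] by simp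
  also have "\<dots> = (LINT t|lborel. of_real (triangle t) * g (of_real \<epsilon> + \<i> * of_real (\<mu> * t)) * exp (\<i> * of_real (t * (\<mu> * y))))"
  proof (rule Bochner_Integration.integral_cong[OF refl])
    fix t
    define w where "w = of_real \<epsilon> + \<i> * of_real (\<mu> * t)"
    have "F u t = (of_real (triangle t) * exp (\<i> * of_real (t * (\<mu> * y)))) * (of_real (A u) * exp (-(w * of_real u)))" for u
    proof -
      have 1: "complex_of_real (exp (-(\<epsilon> * u))) = exp (- (of_real \<epsilon> * of_real u))" by (simp flip: exp_of_real)
      have 2: "exp (- (of_real \<epsilon> * of_real u)) * exp (\<i> * of_real (t * (\<mu> * (y - u)))) = exp (\<i> * of_real (t * (\<mu> * y))) * exp (-(w * complex_of_real u))"
        unfolding exp_add[symmetric] w_def by (rule arg_cong[where f=exp]) (simp add: algebra_simps)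
      have "F u t = of_real (A u) * of_real (triangle t) * (exp (- (of_real \<epsilon> * of_real u)) * exp (\<i> * of_real (t * (\<mu> * (y - u)))))"
        unfolding F_def of_real_mult[of "A u"] 1 by (simp only: mult_ac)
      thus ?thesis unfolding 2 by (simp only: mult_ac)
    qed
    hence "(LINT u|lborel. F u t) = (of_real (triangle t) * exp (\<i> * of_real (t * (\<mu> * y)))) * (LINT u|lborel. of_real (A u) * exp (-(w * of_real u)))"
      by (simp only: integral_mult_right_zero)
    also have "(LINT u|lborel. of_real (A u) * exp (-(w * of_real u))) = g w"
      by (rule lap) (use e in \<open>simp add: w_def\<close>)
    finally show "(LINT u|lborel. F u t) = of_real (triangle t) * g (of_real \<epsilon> + \<i> * of_real (\<mu> * t)) * exp (\<i> * of_real (t * (\<mu> * y)))"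
      unfolding w_def by (simp only: mult_ac)
  qed
  finally show ?thesis using 1 by simp
qed

text \<open>
  The limit $\epsilon \to 0$ of the previous identity, by dominated convergence on both sides. On the right the
  compact support of the triangle function is needed: only the continuity of $g$ up to the boundary is known.
\<close>
lemma smoothed_boundary_identity:
  fixes A :: "real \<Rightarrow> real" and g :: "complex \<Rightarrow> complex"
  assumes A [measurable]: "A \<in> borel_measurable borel"
    and bound: "\<And>u. \<bar>A u\<bar> \<le> C" and neg: "\<And>u. u < 0 \<Longrightarrow> A u = 0"
    and lap: "\<And>w. Re w > 0 \<Longrightarrow> (LINT u|lborel. of_real (A u) * exp (-(w * of_real u))) = g w"
    and g: "continuous_on {w. Re w \<ge> 0} g" and l: "\<mu> > 0"
  shows "of_real (LINT u|lborel. A u * fejer (\<mu> * (y - u))) 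
     = (LINT t|lborel. of_real (triangle t) * g (\<i> * of_real (\<mu> * t)) * exp (\<i> * of_real (t * (\<mu> * y))))"
proof -
  define e where "e = (\<lambda>n. 1 / real (Suc n))"
  have e: "e n > 0" "e n \<le> 1" for n by (auto simp: e_def)
  have elim0: "e \<longlonglongrightarrow> 0" unfolding e_def by real_asymp
  have fm [measurable]: "(\<lambda>u. fejer (\<mu> * (y - u))) \<in> borel_measurable borel" by measurable
  have "(\<lambda>n. LINT u|lborel. A u * exp (-(e n * u)) * fejer (\<mu> * (y - u))) \<longlonglongrightarrow> (LINT u|lborel. A u * fejer (\<mu> * (y - u)))"
  proof (rule integral_dominated_convergence)
    show "integrable lborel (\<lambda>u. C * fejer (\<mu> * (y - u)))"
      by (intro integrable_mult_right fejer_shift_integrable l)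
    show "AE u in lborel. (\<lambda>n. A u * exp (-(e n * u)) * fejer (\<mu> * (y - u))) \<longlonglongrightarrow> A u * fejer (\<mu> * (y - u))"
      by (intro AE_I2) (auto intro!: tendsto_eq_intros elim0)
    show "AE u in lborel. norm (A u * exp (-(e n * u)) * fejer (\<mu> * (y - u))) \<le> C * fejer (\<mu> * (y - u))" for n
    proof (rule AE_I2)
      fix u
      have "\<bar>A u\<bar> * exp (-(e n * u)) \<le> C"
      proof (cases "u < 0")
        case False
        have "\<bar>A u\<bar> * exp (-(e n * u)) \<le> \<bar>A u\<bar> * 1"
          using False e(1)[of n] by (intro mult_left_mono) auto
        thus ?thesis using bound[of u] by simp
      qed (use neg[of u] bound[of u] in auto)
      thus "norm (A u * exp (-(e n * u)) * fejer (\<mu> * (y - u))) \<le> C * fejer (\<mu> * (y - u))"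
        by (simp add: abs_mult fejer_nonneg mult_right_mono)
    qed
  qed measurable
  hence L1: "(\<lambda>n. complex_of_real (LINT u|lborel. A u * exp (-(e n * u)) * fejer (\<mu> * (y - u)))) \<longlonglongrightarrow> of_real (LINT u|lborel. A u * fejer (\<mu> * (y - u)))"
    by (rule tendsto_of_real)
  define K where "K = cbox (0 - \<i> * of_real \<mu>) (1 + \<i> * of_real \<mu>)"
  have Ks: "K \<subseteq> {w. Re w \<ge> 0}" by (auto simp: K_def in_cbox_complex_iff)
  have "compact (g ` K)" using g Ks by (intro compact_continuous_image continuous_on_subset[OF g]) (auto simp: K_def)
  then obtain M where M: "\<And>w. w \<in> K \<Longrightarrow> norm (g w) \<le> M"
    using compact_imp_bounded[of "g ` K"] unfolding bounded_iff by blast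
  have gm: "(\<lambda>t. g (of_real a + \<i> * of_real (\<mu> * t))) \<in> borel_measurable borel" if "a \<ge> 0" for a
    by (intro borel_measurable_continuous_onI continuous_on_compose2[OF g]) (use that in \<open>auto intro!: continuous_intros\<close>)
  have L2: "(\<lambda>n. LINT t|lborel. of_real (triangle t) * g (of_real (e n) + \<i> * of_real (\<mu> * t)) * exp (\<i> * of_real (t * (\<mu> * y))))
     \<longlonglongrightarrow> (LINT t|lborel. of_real (triangle t) * g (\<i> * of_real (\<mu> * t)) * exp (\<i> * of_real (t * (\<mu> * y))))"
  proof (rule integral_dominated_convergence)
    show "integrable lborel (\<lambda>t. M * triangle t)" by (intro integrable_mult_right integrable_triangle)
    show "(\<lambda>t. of_real (triangle t) * g (\<i> * of_real (\<mu> * t)) * exp (\<i> * of_real (t * (\<mu> * y)))) \<in> borel_measurable lborel"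
      using gm[of 0] by simp
    show "(\<lambda>t. of_real (triangle t) * g (of_real (e n) + \<i> * of_real (\<mu> * t)) * exp (\<i> * of_real (t * (\<mu> * y)))) \<in> borel_measurable lborel" for n
      using gm[of "e n"] e(1)[of n] by simp
    show "AE t in lborel. (\<lambda>n. of_real (triangle t) * g (of_real (e n) + \<i> * of_real (\<mu> * t)) * exp (\<i> * of_real (t * (\<mu> * y)))) \<longlonglongrightarrow> of_real (triangle t) * g (\<i> * of_real (\<mu> * t)) * exp (\<i> * of_real (t * (\<mu> * y)))"
    proof (rule AE_I2)
      fix t
      have "(\<lambda>n. complex_of_real (e n) + \<i> * of_real (\<mu> * t)) \<longlonglongrightarrow> of_real 0 + \<i> * of_real (\<mu> * t)"
        by (intro tendsto_intros elim0)
      hence "(\<lambda>n. g (complex_of_real (e n) + \<i> * of_real (\<mu> * t))) \<longlonglongrightarrow> g (of_real 0 + \<i> * of_real (\<mu> * t))"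
        by (rule continuous_on_tendsto_compose[OF g]) (use e in \<open>auto intro!: always_eventually less_imp_le\<close>)
      hence "(\<lambda>n. g (complex_of_real (e n) + \<i> * of_real (\<mu> * t))) \<longlonglongrightarrow> g (\<i> * of_real (\<mu> * t))" by simp
      thus "(\<lambda>n. of_real (triangle t) * g (of_real (e n) + \<i> * of_real (\<mu> * t)) * exp (\<i> * of_real (t * (\<mu> * y)))) \<longlonglongrightarrow> of_real (triangle t) * g (\<i> * of_real (\<mu> * t)) * exp (\<i> * of_real (t * (\<mu> * y)))"
        by (intro tendsto_mult tendsto_const)
    qed
    show "AE t in lborel. norm (of_real (triangle t) * g (of_real (e n) + \<i> * of_real (\<mu> * t)) * exp (\<i> * of_real (t * (\<mu> * y)))) \<le> M * triangle t" for n
    proof (rule AE_I2)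
      fix t
      show "norm (of_real (triangle t) * g (of_real (e n) + \<i> * of_real (\<mu> * t)) * exp (\<i> * of_real (t * (\<mu> * y)))) \<le> M * triangle t"
      proof (cases "\<bar>t\<bar> \<ge> 1")
        case False
        hence t: "\<mu> * t \<le> \<mu> * 1" "\<mu> * (-1) \<le> \<mu> * t" using l by (intro mult_left_mono; simp)+
        have "norm (g (of_real (e n) + \<i> * of_real (\<mu> * t))) \<le> M"
          using t e[of n] less_imp_le[OF e(1)[of n]] by (intro M) (auto simp: K_def in_cbox_complex_iff)
        from mult_left_mono[OF this triangle_bounds(1)[of t]] show ?thesis
          by (simp add: norm_mult triangle_bounds mult.commute)
      qed (simp add: triangle_bounds)
    qed
  qed
  have "(\<lambda>n. complex_of_real (LINT u|lborel. A u * exp (-(e n * u)) * fejer (\<mu> * (y - u)))) =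
     (\<lambda>n. LINT t|lborel. of_real (triangle t) * g (of_real (e n) + \<i> * of_real (\<mu> * t)) * exp (\<i> * of_real (t * (\<mu> * y))))"
    by (rule ext) (rule smoothed_laplace_identity[OF A bound neg lap e(1) l])
  from LIMSEQ_unique[OF L1[unfolded this] L2] show ?thesis .
qed

lemma smoothed_tendsto_0:
  fixes A :: "real \<Rightarrow> real" and g :: "complex \<Rightarrow> complex"
  assumes A: "A \<in> borel_measurable borel"
    and bound: "\<And>u. \<bar>A u\<bar> \<le> C" and neg: "\<And>u. u < 0 \<Longrightarrow> A u = 0"
    and lap: "\<And>w. Re w > 0 \<Longrightarrow> (LINT u|lborel. of_real (A u) * exp (-(w * of_real u))) = g w"
    and g: "continuous_on {w. Re w \<ge> 0} g" and l: "\<mu> > 0"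
  shows "((\<lambda>y. LINT u|lborel. A u * fejer (\<mu> * (y - u))) \<longlongrightarrow> 0) at_top"
proof -
  define h where "h = (\<lambda>t. of_real (triangle t) * g (\<i> * of_real (\<mu> * t)))"
  have "continuous_on UNIV (\<lambda>t. g (\<i> * of_real (\<mu> * t)))"
    by (intro continuous_on_compose2[OF g]) (auto intro!: continuous_intros)
  hence "continuous_on UNIV h"
    unfolding h_def triangle_def by (intro continuous_intros)
  hence "((\<lambda>y. LINT t|lborel. h t * exp (\<i> * of_real (t * y))) \<longlongrightarrow> 0) at_top"
    by (rule riemann_lebesgue) (simp add: h_def triangle_bounds)
  moreover have "filterlim (\<lambda>y. \<mu> * y) at_top at_top"
    using l by (intro filterlim_tendsto_pos_mult_at_top[OF tendsto_const _ filterlim_ident])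
  ultimately have "((\<lambda>y. LINT t|lborel. h t * exp (\<i> * of_real (t * (\<mu> * y)))) \<longlongrightarrow> 0) at_top"
    by (rule filterlim_compose)
  moreover have "complex_of_real (LINT u|lborel. A u * fejer (\<mu> * (y - u))) = (LINT t|lborel. h t * exp (\<i> * of_real (t * (\<mu> * y))))" for y
    unfolding h_def by (rule smoothed_boundary_identity[OF A bound neg lap g l])
  ultimately have "((\<lambda>y. complex_of_real (LINT u|lborel. A u * fejer (\<mu> * (y - u)))) \<longlongrightarrow> of_real 0) at_top"
    by simp
  thus ?thesis by (simp only: tendsto_of_real_iff)
qed

text \<open>
  Let $A$ be bounded, vanish on the negative axis, and be slowly decreasing in the sense that $e^u (A(u) + 1)$ is monotone
  for $u \ge 0$. If its Laplace transform extends continuously to $\Re w \ge 0$, then $\liminf A \ge 0$.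
\<close>
lemma tauberian_lower:
  fixes A :: "real \<Rightarrow> real" and g :: "complex \<Rightarrow> complex"
  assumes A [measurable]: "A \<in> borel_measurable borel"
    and bound: "\<And>u. \<bar>A u\<bar> \<le> C" and neg: "\<And>u. u < 0 \<Longrightarrow> A u = 0"
    and lap: "\<And>w. Re w > 0 \<Longrightarrow> (LINT u|lborel. of_real (A u) * exp (-(w * of_real u))) = g w"
    and g: "continuous_on {w. Re w \<ge> 0} g"
    and slow: "\<And>u v. 0 \<le> u \<Longrightarrow> u \<le> v \<Longrightarrow> A u + 1 \<le> exp (v - u) * (A v + 1)"
    and d: "0 < \<delta>" "\<delta> < 1"
  shows "\<forall>\<^sub>F y in at_top. A y > -\<delta>"
proof -
  define J where "J = (LINT v|lborel. fejer v)"
  have J: "J > 0" unfolding J_def by (rule integral_fejer_pos)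
  \<comment> \<open>If $A(y_0) \le -\delta$, then $A \le -\delta/2$ on the interval of length $\eta$ to the left of $y_0$.\<close>
  define \<eta> where "\<eta> = ln ((1 - \<delta>/2) / (1 - \<delta>))"
  have eta: "\<eta> > 0" "exp \<eta> * (1 - \<delta>) = 1 - \<delta>/2" using d by (auto simp: \<eta>_def field_simps)
  \<comment> \<open>An upper bound for $A$ times the kernel, in the rescaled variable $v = \mu (y - u)$.\<close>
  define \<phi> where "\<phi> = (\<lambda>V v. (if \<bar>v\<bar> \<le> V then -\<delta>/2 else C) * fejer v)"
  have C: "C \<ge> 0" using bound[of 0] by linarith
  have phim [measurable]: "\<phi> V \<in> borel_measurable borel" for V unfolding \<phi>_def by measurable
  have phi_bd: "\<bar>\<phi> V v\<bar> \<le> (C + 1) * fejer v" for V v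
  proof -
    have "\<bar>if \<bar>v\<bar> \<le> V then -\<delta>/2 else C\<bar> \<le> C + 1" using C d by auto
    from mult_right_mono[OF this fejer_nonneg[of v]] show ?thesis
      by (simp only: \<phi>_def abs_mult abs_of_nonneg[OF fejer_nonneg])
  qed
  have phi_int: "integrable lborel (\<phi> V)" for V
    by (rule Bochner_Integration.integrable_bound[OF integrable_mult_right[OF integrable_fejer, of "C+1"]])
       (use phi_bd C fejer_nonneg in \<open>auto simp: abs_mult\<close>)
  have "((\<lambda>V. LINT v|lborel. \<phi> V v) \<longlongrightarrow> (LINT v|lborel. (-\<delta>/2) * fejer v)) at_top"
  proof (rule integral_dominated_convergence_at_top)
    show "integrable lborel (\<lambda>v. (C + 1) * fejer v)" by (intro integrable_mult_right integrable_fejer)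
    show "AE v in lborel. ((\<lambda>V. \<phi> V v) \<longlongrightarrow> (-\<delta>/2) * fejer v) at_top"
    proof (rule AE_I2)
      fix v
      have "\<forall>\<^sub>F V in at_top. (-\<delta>/2) * fejer v = \<phi> V v"
        using eventually_ge_at_top[of "\<bar>v\<bar>"] by eventually_elim (simp add: \<phi>_def)
      thus "((\<lambda>V. \<phi> V v) \<longlongrightarrow> (-\<delta>/2) * fejer v) at_top" by (rule Lim_transform_eventually[OF tendsto_const])
    qed
  qed (use phi_bd in auto)
  also have "(LINT v|lborel. (-\<delta>/2) * fejer v) = (-\<delta>/2) * J" unfolding J_def by (rule integral_mult_right_zero)
  finally have "\<forall>\<^sub>F V in at_top. (LINT v|lborel. \<phi> V v) < 0"
    by (rule order_tendstoD) (use d J in auto)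
  then obtain V where V: "V > 0" "(LINT v|lborel. \<phi> V v) < 0"
    using eventually_happens[OF eventually_conj[OF eventually_gt_at_top[of 0]]] by force
  \<comment> \<open>With this scale, the condition $|v| \le V$ means $|y - u| \le \eta/2$.\<close>
  define \<mu> where "\<mu> = 2 * V / \<eta>"
  have l: "\<mu> > 0" using V eta by (simp add: \<mu>_def)
  define K where "K = (LINT v|lborel. \<phi> V v) / \<mu>"
  have K: "K < 0" using V l by (simp add: K_def divide_neg_pos)
  have "\<forall>\<^sub>F y in at_top. (LINT u|lborel. A u * fejer (\<mu> * (y - u))) > K"
    using order_tendstoD(1)[OF smoothed_tendsto_0[OF A bound neg lap g l] K] .
  then obtain Y where Y: "\<And>y. y \<ge> Y \<Longrightarrow> (LINT u|lborel. A u * fejer (\<mu> * (y - u))) > K"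
    unfolding eventually_at_top_linorder by blast
  show ?thesis
    unfolding eventually_at_top_linorder
  proof (intro exI allI impI)
    fix y0 assume y0: "y0 \<ge> max \<eta> (Y + \<eta>)"
    show "A y0 > -\<delta>"
    proof (rule ccontr)
      assume "\<not> A y0 > -\<delta>"
      hence Ay0: "A y0 \<le> -\<delta>" by simp
      define y where "y = y0 - \<eta> / 2"
      have near: "A u \<le> -\<delta>/2" if u: "y0 - \<eta> \<le> u" "u \<le> y0" for u
      proof -
        have "A u + 1 \<le> exp (y0 - u) * (A y0 + 1)" using u y0 by (intro slow) auto
        also have "\<dots> \<le> exp (y0 - u) * (1 - \<delta>)" using Ay0 by (intro mult_left_mono) auto
        also have "\<dots> \<le> exp \<eta> * (1 - \<delta>)" using u d by (intro mult_right_mono) auto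
        finally show ?thesis using eta by simp
      qed
      have "(LINT u|lborel. A u * fejer (\<mu> * (y - u))) \<le> (LINT u|lborel. \<phi> V (\<mu> * y + (-\<mu>) * u))"
      proof (rule integral_mono)
        show "integrable lborel (\<lambda>u. \<phi> V (\<mu> * y + (-\<mu>) * u))"
          using l by (intro lborel_integrable_real_affine phi_int) auto
        show "integrable lborel (\<lambda>u. A u * fejer (\<mu> * (y - u)))"
        proof (rule Bochner_Integration.integrable_bound[OF integrable_mult_right[OF fejer_shift_integrable[OF l, of y], of C]])
          show "AE u in lborel. norm (A u * fejer (\<mu> * (y - u))) \<le> norm (C * fejer (\<mu> * (y - u)))"
            using bound C fejer_nonneg by (intro AE_I2) (auto simp: abs_mult intro!: mult_right_mono)
        qed measurable
        fix u
        have eq: "\<mu> * y + (-\<mu>) * u = \<mu> * (y - u)" by (simp add: algebra_simps)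
        have "A u \<le> (if \<bar>\<mu> * (y - u)\<bar> \<le> V then -\<delta>/2 else C)"
        proof (cases "\<bar>\<mu> * (y - u)\<bar> \<le> V")
          case True
          hence "\<mu> * \<bar>y - u\<bar> \<le> V" using l by (simp add: abs_mult)
          hence "\<bar>y - u\<bar> \<le> \<eta> / 2" using V eta by (simp add: \<mu>_def field_simps)
          hence "y0 - \<eta> \<le> u" "u \<le> y0" unfolding y_def by linarith+
          thus ?thesis using near True by simp
        next
          case False
          have "A u \<le> C" using bound[of u] by simp
          thus ?thesis using False by simp
        qed
        thus "A u * fejer (\<mu> * (y - u)) \<le> \<phi> V (\<mu> * y + (-\<mu>) * u)"
          unfolding eq \<phi>_def by (intro mult_right_mono fejer_nonneg)
      qed
      also have "\<dots> = K"
        unfolding K_def using lborel_integral_real_affine[of "-\<mu>" "\<phi> V" "\<mu> * y"] l by simp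
      finally show False using Y[of y] y0 eta by (simp add: y_def)
    qed
  qed
qed

section \<open>The lower bound for the Chebyshev function\<close>

text \<open>
  The relative error $\psi(e^u)/e^u - 1$ on a logarithmic scale, extended by $0$ to negative $u$.
\<close>
definition psi_err :: "real \<Rightarrow> real" where
  "psi_err u = (if u \<ge> 0 then psi (exp u) * exp (-u) - 1 else 0)"

text \<open>
  The Laplace transform of \<open>psi_err\<close> for $\Re w > 0$; it is continuous on $\Re w \ge 0$.
\<close>
definition psi_transform :: "complex \<Rightarrow> complex" where
  "psi_transform w = - (deriv zeta_reg (1 + w) / zeta_reg (1 + w) + 1) / (1 + w)"

lemma psi_measurable [measurable]: "psi \<in> borel_measurable borel"
  by (rule borel_measurable_mono) (auto intro!: monoI psi_mono)

lemma psi_err_measurable [measurable]: "psi_err \<in> borel_measurable borel"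
  unfolding psi_err_def by measurable

lemma psi_err_bound: "\<bar>psi_err u\<bar> \<le> 4"
proof -
  have "psi (exp u) * exp (-u) \<le> 4 * exp u * exp (-u)" by (intro mult_right_mono psi_le) auto
  also have "4 * exp u * exp (-u) = 4" by (simp add: exp_minus)
  finally have "psi (exp u) * exp (-u) \<le> 4" .
  moreover have "psi (exp u) * exp (-u) \<ge> 0" using psi_nonneg by simp
  ultimately have "\<bar>psi (exp u) * exp (-u) - 1\<bar> \<le> 4" by linarith
  thus ?thesis by (simp add: psi_err_def)
qed

lemma psi_err_slow:
  assumes "0 \<le> u" "u \<le> v"
  shows "psi_err u + 1 \<le> exp (v - u) * (psi_err v + 1)"
proof -
  have "psi (exp u) * exp (-u) \<le> psi (exp v) * exp (-u)" using assms by (intro mult_right_mono psi_mono) auto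
  also have "\<dots> = exp (v - u) * (psi (exp v) * exp (-v))" by (simp add: exp_diff exp_minus field_simps)
  finally have "psi (exp u) * exp (-u) \<le> exp (v - u) * (psi (exp v) * exp (-v))" .
  moreover have "psi_err u + 1 = psi (exp u) * exp (-u)" "psi_err v + 1 = psi (exp v) * exp (-v)"
    using assms by (simp_all add: psi_err_def)
  ultimately show ?thesis by (simp only:)
qed

lemma continuous_psi_transform: "continuous_on {w. Re w \<ge> 0} psi_transform"
proof -
  have o: "open {s. Re s > 0}" by (rule open_halfspace_Re_gt)
  have c1: "continuous_on {s. Re s > 0} zeta_reg" by (rule holomorphic_on_imp_continuous_on[OF holomorphic_zeta_reg])
  have c2: "continuous_on {s. Re s > 0} (deriv zeta_reg)" by (rule holomorphic_on_imp_continuous_on[OF holomorphic_deriv[OF holomorphic_zeta_reg o]])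
  have c: "continuous_on {w. Re w \<ge> 0} (\<lambda>w. f (1 + w))" if "continuous_on {s. Re s > 0} f" for f :: "complex \<Rightarrow> complex"
    by (rule continuous_on_compose2[OF that]) (auto intro!: continuous_intros)
  have nz: "zeta_reg (1 + w) \<noteq> 0" "1 + w \<noteq> 0" if "Re w \<ge> 0" for w
    using zeta_reg_nonzero[of "1 + w"] that by (auto simp: complex_eq_iff[of "1 + w" 0])
  show ?thesis unfolding psi_transform_def
    by (intro continuous_on_divide continuous_on_minus continuous_on_add continuous_on_const continuous_on_id c c1 c2)
       (use nz in auto)
qed

lemma psi_exp_eq_suminf: "psi (exp u) = (\<Sum>n. mangoldt (Suc n) * indicator {ln (real (Suc n))..} u)"
  and finite_psi_support: "finite {n. mangoldt (Suc n) * indicator {ln (real (Suc n))..} u \<noteq> (0::real)}"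
proof -
  define N where "N = nat \<lfloor>exp u\<rfloor>"
  have iff: "indicator {ln (real (Suc n))..} u = (if n < N then 1 else 0 :: real)" for n
  proof -
    have "ln (real (Suc n)) \<le> u \<longleftrightarrow> real (Suc n) \<le> exp u"
      by (metis exp_le_cancel_iff exp_ln of_nat_0_less_iff zero_less_Suc)
    also have "\<dots> \<longleftrightarrow> Suc n \<le> N" 
    proof
      assume "Suc n \<le> N"
      hence "real (Suc n) \<le> real N" by (rule of_nat_mono)
      also have "\<dots> \<le> exp u" unfolding N_def by (rule of_nat_floor) simp
      finally show "real (Suc n) \<le> exp u" .
    qed (simp only: N_def le_nat_floor)
    finally show ?thesis by (auto simp: indicator_def)
  qed
  show "finite {n. mangoldt (Suc n) * indicator {ln (real (Suc n))..} u \<noteq> (0::real)}"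
    by (rule finite_subset[of _ "{..<N}"]) (auto simp: iff simp del: of_nat_Suc split: if_splits)
  have "(\<Sum>n. mangoldt (Suc n) * indicator {ln (real (Suc n))..} u :: real) = (\<Sum>n<N. mangoldt (Suc n) * indicator {ln (real (Suc n))..} u)"
    by (rule suminf_finite) (auto simp: iff simp del: of_nat_Suc)
  also have "\<dots> = (\<Sum>n<N. mangoldt (Suc n))" by (simp add: iff del: of_nat_Suc)
  also have "\<dots> = (\<Sum>d\<in>{1..N}. mangoldt d)"
    by (rule sum.reindex_bij_witness[where i="\<lambda>d. d - 1" and j=Suc]) auto
  finally show "psi (exp u) = (\<Sum>n. mangoldt (Suc n) * indicator {ln (real (Suc n))..} u)"
    by (simp add: psi_def N_def)
qed

text \<open>
  Termwise integration of $\psi(e^u) = \sum_m \Lambda(m) [u \ge \ln m]$.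
\<close>
lemma laplace_psi:
  assumes s: "Re s > 1"
  shows "has_bochner_integral lborel (\<lambda>u. of_real (psi (exp u)) * exp (-(s * of_real u))) (mangoldt_series s / s)"
proof -
  have s0: "Re s > 0" "s \<noteq> 0" using s by auto
  define f where "f = (\<lambda>n u. complex_of_real (mangoldt (Suc n)) * (indicator {ln (real (Suc n))..} u *\<^sub>R exp (-(s * of_real u))))"
  have pw: "exp (-(z * of_real (ln (real (Suc n))))) = of_nat (Suc n) powr (-z)" for z :: complex and n
  proof -
    have "Ln (of_nat (Suc n)) = of_real (ln (real (Suc n)))"
      by (metis Ln_of_real of_nat_0_less_iff of_real_of_nat_eq zero_less_Suc)
    thus ?thesis by (simp add: powr_def del: of_nat_Suc)
  qed
  have hf: "has_bochner_integral lborel (f n) (of_real (mangoldt (Suc n)) * (of_nat (Suc n) powr (-s) / s))" for n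
    unfolding f_def using has_bochner_integral_exp_Ici[OF s0(1), of "ln (real (Suc n))"]
    by (intro has_bochner_integral_mult_right) (simp only: pw)
  have hn: "has_bochner_integral lborel (\<lambda>u. norm (f n u)) (mangoldt (Suc n) * (real (Suc n) powr (-Re s) / Re s))" for n
  proof -
    have "has_bochner_integral lborel (\<lambda>u. indicator {ln (real (Suc n))..} u *\<^sub>R exp (-(of_real (Re s) * complex_of_real u))) (of_nat (Suc n) powr (-of_real (Re s)) / of_real (Re s))"
      using has_bochner_integral_exp_Ici[of "of_real (Re s)" "ln (real (Suc n))"] s0 by (simp only: pw) simp
    from has_bochner_integral_Re[OF this] 
    have "has_bochner_integral lborel (\<lambda>u. Re (indicator {ln (real (Suc n))..} u *\<^sub>R exp (-(of_real (Re s) * complex_of_real u)))) (Re (of_nat (Suc n) powr (-of_real (Re s)) / of_real (Re s)))" .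
    also have "(\<lambda>u. Re (indicator {ln (real (Suc n))..} u *\<^sub>R exp (-(of_real (Re s) * complex_of_real u)))) = (\<lambda>u. indicator {ln (real (Suc n))..} u * exp (-(Re s * u)))"
      by (rule ext) (simp add: Re_exp)
    also have "Re (of_nat (Suc n) powr (-of_real (Re s)) / of_real (Re s)) = real (Suc n) powr (-Re s) / Re s"
    proof -
      have "complex_of_nat (Suc n) powr (-of_real (Re s)) = of_real (real (Suc n) powr (-Re s))"
        using powr_of_real[of "real (Suc n)" "-Re s"] by simp
      thus ?thesis by (metis Re_complex_of_real of_real_divide)
    qed
    finally have "has_bochner_integral lborel (\<lambda>u. mangoldt (Suc n) * (indicator {ln (real (Suc n))..} u * exp (-(Re s * u)))) (mangoldt (Suc n) * (real (Suc n) powr (-Re s) / Re s))"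
      by (rule has_bochner_integral_mult_right)
    also have "(\<lambda>u. mangoldt (Suc n) * (indicator {ln (real (Suc n))..} u * exp (-(Re s * u)))) = (\<lambda>u. norm (f n u))"
      by (rule ext) (simp add: f_def norm_mult mangoldt_nonneg)
    finally show ?thesis .
  qed
  have sumf: "(\<Sum>n. f n u) = of_real (psi (exp u)) * exp (-(s * of_real u))" 
    and summ: "summable (\<lambda>n. norm (f n u))" for u
  proof -
    have e: "f n u = of_real (mangoldt (Suc n) * indicator {ln (real (Suc n))..} u) * exp (-(s * of_real u))" for n
      by (simp add: f_def scaleR_conv_of_real)
    have sm: "summable (\<lambda>n. mangoldt (Suc n) * indicator {ln (real (Suc n))..} u :: real)"
      by (rule summable_finite[OF finite_psi_support[of u]]) auto
    have "(\<lambda>n. complex_of_real (mangoldt (Suc n) * indicator {ln (real (Suc n))..} u)) sums of_real (psi (exp u))"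
      unfolding psi_exp_eq_suminf using sm by (intro sums_of_real summable_sums)
    from sums_mult2[OF this] show "(\<Sum>n. f n u) = of_real (psi (exp u)) * exp (-(s * of_real u))"
      unfolding e by (rule sums_unique[symmetric])
    show "summable (\<lambda>n. norm (f n u))"
      by (rule summable_finite[OF finite_psi_support[of u]]) (simp add: e del: of_real_mult)
  qed
  have S1: "summable (\<lambda>n. LINT u|lborel. norm (f n u))"
  proof -
    have "summable (\<lambda>n. \<bar>mangoldt (Suc n)\<bar> * real (Suc n) powr (-Re s))"
      by (intro summable_ln_powr mangoldt_Suc_bound s)
    hence "summable (\<lambda>n. (mangoldt (Suc n) * real (Suc n) powr (-Re s)) / Re s)"
      by (intro summable_divide) simp
    thus ?thesis using has_bochner_integral_integral_eq[OF hn] by (simp del: of_nat_Suc)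
  qed
  have int: "integrable lborel (f n)" for n using hf by (simp add: has_bochner_integral_iff)
  have I1: "integrable lborel (\<lambda>u. \<Sum>n. f n u)"
    by (rule integrable_suminf[OF int _ S1]) (use summ in simp)
  have I2: "(LINT u|lborel. (\<Sum>n. f n u)) = (\<Sum>n. integral\<^sup>L lborel (f n))"
    by (rule integral_suminf[OF int _ S1]) (use summ in simp)
  have "(\<lambda>n. of_real (mangoldt (Suc n)) * of_nat (Suc n) powr (-s)) sums mangoldt_series s"
    unfolding dirichlet_series_def
    by (intro summable_sums summable_norm_cancel[OF summable_dirichlet_series] mangoldt_Suc_bound s)
  from sums_divide[OF this, of s] have "(\<lambda>n. integral\<^sup>L lborel (f n)) sums (mangoldt_series s / s)"
    using has_bochner_integral_integral_eq[OF hf] by (simp del: of_nat_Suc)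
  hence "(\<Sum>n. integral\<^sup>L lborel (f n)) = mangoldt_series s / s" by (rule sums_unique[symmetric])
  with I1 I2 show ?thesis by (simp add: has_bochner_integral_iff sumf)
qed

lemma laplace_psi_err:
  assumes w: "Re w > 0"
  shows "(LINT u|lborel. of_real (psi_err u) * exp (-(w * of_real u))) = psi_transform w"
proof -
  define s where "s = 1 + w"
  have s: "Re s > 1" "s - 1 = w" using w by (auto simp: s_def)
  have nz: "w \<noteq> 0" "s \<noteq> 0" "zeta_reg s \<noteq> 0" using w s zeta_reg_nonzero[of s] by auto
  have "has_bochner_integral lborel (\<lambda>u. of_real (psi (exp u)) * exp (-(s * of_real u)) - indicator {0..} u *\<^sub>R exp (-(w * of_real u))) (mangoldt_series s / s - exp (-(w * of_real 0)) / w)"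
    by (intro has_bochner_integral_diff laplace_psi s has_bochner_integral_exp_Ici w)
  also have "(\<lambda>u. of_real (psi (exp u)) * exp (-(s * of_real u)) - indicator {0..} u *\<^sub>R exp (-(w * of_real u))) = (\<lambda>u. of_real (psi_err u) * exp (-(w * of_real u)))"
  proof
    fix u :: real
    show "of_real (psi (exp u)) * exp (-(s * of_real u)) - indicator {0..} u *\<^sub>R exp (-(w * of_real u)) = of_real (psi_err u) * exp (-(w * of_real u))"
    proof (cases "u \<ge> 0")
      case True
      have "exp (-(s * of_real u)) = complex_of_real (exp (-u)) * exp (-(w * of_real u))"
        by (simp add: s_def exp_of_real[symmetric] exp_add[symmetric] algebra_simps)
      thus ?thesis using True by (simp add: psi_err_def algebra_simps)
    next
      case False
      hence "psi (exp u) = 0" by (simp add: psi_def)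
      thus ?thesis using False by (simp add: psi_err_def)
    qed
  qed
  also have "mangoldt_series s / s - exp (-(w * of_real 0)) / w = psi_transform w"
  proof -
    have "deriv zeta_reg s / zeta_reg s = 1 / w - mangoldt_series s"
      using deriv_zeta_reg_eq[OF s(1)] nz unfolding s(2) by (simp add: field_simps)
    hence "psi_transform w = - (1 / w - mangoldt_series s + 1) / s" by (simp add: psi_transform_def s_def[symmetric])
    also have "1 / w + 1 = s / w" using nz by (simp add: s_def field_simps)
    hence "- (1 / w - mangoldt_series s + 1) / s = (mangoldt_series s - s / w) / s" by (simp add: algebra_simps)
    also have "\<dots> = mangoldt_series s / s - 1 / w" using nz by (simp add: diff_divide_distrib)
    finally show ?thesis by simp
  qed
  finally show ?thesis by (rule has_bochner_integral_integral_eq)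
qed

lemma psi_lower_bound:
  assumes "0 < \<delta>" "\<delta> < 1"
  shows "\<forall>\<^sub>F x in at_top. psi x \<ge> (1 - \<delta>) * x"
proof -
  have "\<forall>\<^sub>F u in at_top. psi_err u > -\<delta>"
    by (rule tauberian_lower[OF psi_err_measurable psi_err_bound _ laplace_psi_err continuous_psi_transform psi_err_slow assms])
       (auto simp: psi_err_def)
  hence "\<forall>\<^sub>F x in at_top. psi_err (ln x) > -\<delta>"
    using filterlim_iff[THEN iffD1, OF ln_at_top] by blast
  thus ?thesis using eventually_ge_at_top[of 1]
  proof eventually_elim
    case (elim x)
    hence "psi x / x - 1 > -\<delta>" by (simp add: psi_err_def exp_minus field_simps)
    thus ?case using elim by (simp add: field_simps)
  qed
qed

section \<open>Bounds for the primes\<close>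

lemma nth_prime_le:
  assumes "m \<le> prime_pi x" "m \<ge> 1"
  shows "real (nth_prime m) \<le> x"
proof (rule ccontr)
  assume "\<not> real (nth_prime m) \<le> x"
  hence x: "x < real (nth_prime m)" by simp
  let ?P = "{p::nat. prime p}"
  have inf: "infinite ?P" by (rule primes_infinite)
  have "{p. prime p \<and> real p \<le> x} \<subseteq> enumerate ?P ` {..<m-1}"
  proof safe
    fix p :: nat assume p: "prime p" "real p \<le> x"
    then obtain i where i: "enumerate ?P i = p" using enumerate_Ex[OF inf, of p] by auto
    have "enumerate ?P i < enumerate ?P (m - 1)" using i p x by (auto simp: nth_prime_def)
    hence "i < m - 1" using inf by simp
    thus "p \<in> enumerate ?P ` {..<m-1}" using i by auto
  qed
  hence "card {p. prime p \<and> real p \<le> x} \<le> card (enumerate ?P ` {..<m-1})" by (intro card_mono) auto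
  also have "\<dots> \<le> m - 1" using card_image_le[of "{..<m-1}" "enumerate ?P"] by simp
  finally show False using assms by (simp add: prime_pi_def)
qed

text \<open>
  For $x = b\, n \ln n$ the number of primes up to $x$ is at least
  $(1 - \delta) x / \ln x \sim (1 - \delta) b\, n$, which exceeds $n + k$ as soon as $(1 - \delta) b > 1$.
\<close>
lemma nth_prime_upper:
  assumes b: "b > 1"
  shows "\<forall>\<^sub>F n in sequentially. real (nth_prime (n + k)) \<le> b * real n * ln (real n)"
proof -
  define \<delta> where "\<delta> = (b - 1) / (2 * b)"
  have d: "0 < \<delta>" "\<delta> < 1" using b by (auto simp: \<delta>_def field_simps)
  have db: "(1 - \<delta>) * b > 1" using b by (simp add: \<delta>_def field_simps)
  have "filterlim (\<lambda>n::nat. b * real n * ln (real n)) at_top at_top" using b by real_asymp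
  hence "\<forall>\<^sub>F n::nat in at_top. psi (b * real n * ln (real n)) \<ge> (1 - \<delta>) * (b * real n * ln (real n))"
    using psi_lower_bound[OF d] filterlim_iff[THEN iffD1] by blast
  moreover have "\<forall>\<^sub>F n::nat in at_top. b * real n * ln (real n) > 1" using b by real_asymp
  moreover have "\<forall>\<^sub>F n::nat in at_top. (1 - \<delta>) * b * (ln (real n) / ln (b * real n * ln (real n))) > (real n + real k) / real n"
  proof -
    have 1: "(\<lambda>n::nat. ln (real n) / ln (b * real n * ln (real n))) \<longlonglongrightarrow> 1" using b by real_asymp
    have 2: "(\<lambda>n::nat. (real n + real k) / real n) \<longlonglongrightarrow> 1" by real_asymp
    have "(\<lambda>n::nat. (1 - \<delta>) * b * (ln (real n) / ln (b * real n * ln (real n))) - (real n + real k) / real n) \<longlonglongrightarrow> (1 - \<delta>) * b * 1 - 1"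
      by (rule tendsto_diff[OF tendsto_mult[OF tendsto_const 1] 2])
    hence "\<forall>\<^sub>F n::nat in at_top. 0 < (1 - \<delta>) * b * (ln (real n) / ln (b * real n * ln (real n))) - (real n + real k) / real n"
      using db by (intro order_tendstoD(1)) auto
    thus ?thesis by eventually_elim simp
  qed
  moreover have "\<forall>\<^sub>F n::nat in at_top. n \<ge> 1" by (rule eventually_ge_at_top)
  ultimately show ?thesis
  proof eventually_elim
    case (elim n)
    define x where "x = b * real n * ln (real n)"
    have x: "x > 1" "ln x > 0" using elim by (auto simp: x_def)
    have "real n + real k < (1 - \<delta>) * b * (ln (real n) / ln x) * real n"
      using elim by (simp add: x_def divide_less_eq)
    also have "\<dots> = (1 - \<delta>) * x / ln x" by (simp add: x_def)
    also have "\<dots> \<le> psi x / ln x" using elim x by (intro divide_right_mono) (auto simp: x_def)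
    also have "\<dots> \<le> real (prime_pi x)" using psi_le_prime_pi_ln[of x] x by (simp add: divide_le_eq)
    finally have "n + k \<le> prime_pi x" by linarith
    thus ?case using elim nth_prime_le[of "n + k" x] by (simp add: x_def)
  qed
qed

lemma prime_pi_density_0: "(\<lambda>n. real (prime_pi (real n)) / real n) \<longlonglongrightarrow> 0"
proof (rule tendsto_sandwich[OF _ _ tendsto_const])
  show "\<forall>\<^sub>F n in sequentially. real (prime_pi (real n)) / real n \<le> (sqrt (real n) + 8 * real n / ln (real n)) / real n"
    using eventually_gt_at_top[of 1] by eventually_elim (auto intro!: divide_right_mono prime_pi_upper)
  show "(\<lambda>n. (sqrt (real n) + 8 * real n / ln (real n)) / real n) \<longlonglongrightarrow> 0" by real_asymp
qed (auto intro!: always_eventually)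

theorem theorem1:
  fixes c :: real
  assumes "1 < c" and "c < exp 1"
  shows "\<forall>k::nat. \<exists>N::nat. \<forall>n::nat. 0 < n \<and> N < n \<longrightarrow>
           real n ^ (n - prime_pi (real n)) > c ^ nth_prime (n + k)"
proof
  fix k :: nat
  define L where "L = ln c"
  have L: "0 < L" "L < 1" using assms ln_less_cancel_iff[of c "exp 1"] by (auto simp: L_def)
  \<comment> \<open>Any $b$ with $1 < b < 1/L$ will do.\<close>
  define b where "b = (1 + 1 / L) / 2"
  have b: "b > 1" "b * L < 1" using L by (auto simp: b_def field_simps)
  have "\<forall>\<^sub>F n in sequentially. real (prime_pi (real n)) / real n < 1 - b * L"
    using b by (intro order_tendstoD(2)[OF prime_pi_density_0]) simp
  hence "\<forall>\<^sub>F n in sequentially. c ^ nth_prime (n + k) < real n ^ (n - prime_pi (real n))"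
    using nth_prime_upper[OF b(1), of k] eventually_gt_at_top[of 1]
  proof eventually_elim
    case (elim n)
    have ln: "ln (real n) > 0" using elim by simp
    have "ln (c ^ nth_prime (n + k)) = real (nth_prime (n + k)) * L" using assms by (simp add: ln_realpow L_def)
    also have "\<dots> \<le> (b * real n * ln (real n)) * L" using elim L by (intro mult_right_mono) auto
    also have "\<dots> = (b * L * real n) * ln (real n)" by simp
    also have "\<dots> < (real n - real (prime_pi (real n))) * ln (real n)"
      using elim b ln by (intro mult_strict_right_mono) (auto simp: field_simps)
    also have "\<dots> = ln (real n ^ (n - prime_pi (real n)))"
      using elim prime_pi_le[of n] by (simp add: ln_realpow of_nat_diff)
    finally show ?case using assms elim by (subst (asm) ln_less_cancel_iff) auto
  qed
  then obtain N where "\<And>n. n \<ge> N \<Longrightarrow> c ^ nth_prime (n + k) < real n ^ (n - prime_pi (real n))"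
    unfolding eventually_sequentially by blast
  thus "\<exists>N::nat. \<forall>n::nat. 0 < n \<and> N < n \<longrightarrow> real n ^ (n - prime_pi (real n)) > c ^ nth_prime (n + k)"
    by (intro exI[of _ N]) auto
qed

end
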